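(* Let $0<\varphi\le \pi/2$, $c=\cos\varphi$, $s=\sin\varphi$, and let $n\in\{2,3,4,5\}$. Let $D_n\subseteq\mathbb{R}$, the one-parametric family $p_n(\cdot,d)\colon[-1,1]\to\mathbb{R}^2$, $d\in D_n$, of symmetric $G^{n-2}$ polynomial interpolants of degree at most $n$ of the circular arc $\{(\cos\alpha,\sin\alpha):\alpha\in[-\varphi,\varphi]\}$, the radial error $\phi_n$ and the simplified radial error $\psi_n$ be as defined in the context. Then there exists exactly one $d^*\in D_n$ such that $$\max_{t\in[-1,1]}|\phi_n(t,d^* )|=\min_{d\in D_n}\ \max_{t\in[-1,1]}|\phi_n(t,d)|,$$ i.e. the best $G^{n-2}$ interpolant of degree at most $n$ with respect to the radial error exists and is unique. Likewise, there exists exactly one $d^{**}\in D_n$ such that $$\max_{t\in[-1,1]}|\psi_n(t,d^{**})|=\min_{d\in D_n}\ \max_{t\in[-1,1]}|\psi_n(t,d)|.$$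
   Context: Write $B_j^n(t)=\binom{n}{j}\left(\frac{1+t}{2}\right)^j\left(\frac{1-t}{2}\right)^{n-j}$, $j=0,\dots,n$, for the Bernstein polynomials over $[-1,1]$, and set $p_n(t,d)=\sum_{j=0}^n B_j^n(t)\,b_j$ with control points $b_j=b_j(d)\in\mathbb{R}^2$ given below; in all cases $b_{n-j}$ is the reflection of $b_j$ over the first coordinate axis (i.e. the second coordinate changes sign), so only $b_j$ with $j\le n/2$ are listed. The set $D_n$ is the set of admissible parameters. - $n=2$ ($G^0$): $D_2=(1,\infty)$, $b_0=(c,-s)^T$, $b_1=(d,0)^T$. - $n=3$ ($G^1$): $D_3=(0,\infty)$, $b_0=(c,-s)^T$, $b_1=(c,-s)^T+d\,(s,c)^T$. - $n=4$ ($G^2$): $D_4=\{d\in\mathbb{R}: cd<1\}$, $b_0=(c,-s)^T$, $b_1=(c,-s)^T+\frac{\sqrt3}{2}\sqrt{1-cd}\,(s,c)^T$, $b_2=(d,0)^T$. - $n=5$ ($G^3$): $D_5=(0,\infty)$, $b_0=(c,-s)^T$, $b_1=(c,-s)^T+d\,(s,c)^T$, $b_2=\left(\frac{5d(4-5d^2)c+4(2+5d^2)s}{4(5d+2sc)},\,-\frac{5d\left((4-5d^2)s-6dc\right)}{4(5d+2sc)}\right)^T$. The radial error and the simplified radial error are $\phi_n(t,d)=\|p_n(t,d)\|_2-1$ and $\psi_n(t,d)=\|p_n(t,d)\|_2^2-1$, $t\in[-1,1]$, where $\|\cdot\|_2$ is the Euclidean norm. *)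

theory Defs
  imports "HOL-Analysis.Analysis"
begin

definition bernstein_poly :: "nat \<Rightarrow> nat \<Rightarrow> real \<Rightarrow> real" where
  "bernstein_poly n j t =
     of_nat (n choose j) * ((1 + t) / 2) ^ j * ((1 - t) / 2) ^ (n - j)"

text \<open>
  The plane is \<^typ>\<open>real \<times> real\<close>, whose library norm is the Euclidean one.
\<close>

definition reflect_x :: "real \<times> real \<Rightarrow> real \<times> real" where
  "reflect_x p = (fst p, - snd p)"

text \<open>
  For \<open>n \<in> {2, 3, 4, 5}\<close> the list \<open>half_ctrl \<phi> n d\<close> consists of the control points
  \<open>b\<^sub>j\<close> with \<open>2 * j \<le> n\<close>; the remaining ones are their reflections. Other \<open>n\<close> get
  dummy values (and an empty set of admissible parameters).
\<close>

definition half_ctrl :: "real \<Rightarrow> nat \<Rightarrow> real \<Rightarrow> (real \<times> real) list" where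
  "half_ctrl \<phi> n d = (let c = cos \<phi>; s = sin \<phi> in
     if n = 2 then
       [(c, - s), (d, 0)]
     else if n = 3 then
       [(c, - s), (c, - s) + d *\<^sub>R (s, c)]
     else if n = 4 then
       [(c, - s), (c, - s) + (sqrt 3 / 2 * sqrt (1 - c * d)) *\<^sub>R (s, c), (d, 0)]
     else if n = 5 then
       [(c, - s), (c, - s) + d *\<^sub>R (s, c),
        ((5 * d * (4 - 5 * d\<^sup>2) * c + 4 * (2 + 5 * d\<^sup>2) * s) / (4 * (5 * d + 2 * s * c)),
         - (5 * d * ((4 - 5 * d\<^sup>2) * s - 6 * d * c) / (4 * (5 * d + 2 * s * c))))]
     else [])"

definition ctrl_point :: "real \<Rightarrow> nat \<Rightarrow> real \<Rightarrow> nat \<Rightarrow> real \<times> real" where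
  "ctrl_point \<phi> n d j =
     (if 2 * j \<le> n then half_ctrl \<phi> n d ! j else reflect_x (half_ctrl \<phi> n d ! (n - j)))"

definition admissible :: "real \<Rightarrow> nat \<Rightarrow> real set" where
  "admissible \<phi> n =
     (if n = 2 then {1<..}
      else if n = 3 \<or> n = 5 then {0<..}
      else if n = 4 then {d. cos \<phi> * d < 1}
      else {})"

definition interpolant :: "real \<Rightarrow> nat \<Rightarrow> real \<Rightarrow> real \<Rightarrow> real \<times> real" where
  "interpolant \<phi> n t d = (\<Sum>j=0..n. bernstein_poly n j t *\<^sub>R ctrl_point \<phi> n d j)"

definition radial_error :: "real \<Rightarrow> nat \<Rightarrow> real \<Rightarrow> real \<Rightarrow> real" where
  "radial_error \<phi> n t d = norm (interpolant \<phi> n t d) - 1"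

definition simp_radial_error :: "real \<Rightarrow> nat \<Rightarrow> real \<Rightarrow> real \<Rightarrow> real" where
  "simp_radial_error \<phi> n t d = (norm (interpolant \<phi> n t d))\<^sup>2 - 1"

definition max_abs :: "(real \<Rightarrow> real) \<Rightarrow> real" where
  "max_abs f = (SUP t\<in>{-1..1}. \<bar>f t\<bar>)"

text \<open>For continuous \<open>f\<close>, in particular for both errors, the supremum is a maximum.\<close>

lemma max_abs_attained:
  assumes "continuous_on {-1..1} f"
  shows "\<exists>t\<in>{-1..1}. max_abs f = \<bar>f t\<bar> \<and> (\<forall>u\<in>{-1..1}. \<bar>f u\<bar> \<le> \<bar>f t\<bar>)"
proof -
  have "continuous_on {-1..1::real} (\<lambda>t. \<bar>f t\<bar>)"
    using assms by (intro continuous_intros)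
  then obtain t where t: "t \<in> {-1..1}" "\<forall>u\<in>{-1..1}. \<bar>f u\<bar> \<le> \<bar>f t\<bar>"
    using continuous_attains_sup[of "{-1..1::real}" "\<lambda>t. \<bar>f t\<bar>"] by auto
  then have "max_abs f = \<bar>f t\<bar>"
    unfolding max_abs_def by (intro cSup_eq_maximum) auto
  with t show ?thesis by blast
qed

lemma continuous_on_interpolant: "continuous_on A (\<lambda>t. interpolant \<phi> n t d)"
  unfolding interpolant_def bernstein_poly_def by (intro continuous_intros) auto

lemma continuous_on_radial_error: "continuous_on A (\<lambda>t. radial_error \<phi> n t d)"
  unfolding radial_error_def
  by (intro continuous_intros continuous_on_interpolant)

lemma continuous_on_simp_radial_error: "continuous_on A (\<lambda>t. simp_radial_error \<phi> n t d)"
  unfolding simp_radial_error_def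
  by (intro continuous_intros continuous_on_interpolant)

end

theory Submission
  imports Defs
begin

text \<open>
  For every \<open>n\<close> the interpolation conditions force
  \<open>\<psi>\<^sub>n(t, d) = (1 - u)\<^sup>n\<^sup>-\<^sup>1 (X\<^sup>2 - 1 \<plusminus> Y\<^sup>2 u)\<close> with \<open>u = t\<^sup>2\<close>, where \<open>X = X(d)\<close> is the
  first coordinate at \<open>t = 0\<close> and \<open>Y = Y(d)\<close> is the leading coefficient of the curve.
  Compare with the parameter \<open>d\<^sub>0\<close> whose curve passes through \<open>(1, 0)\<close>, i.e. \<open>X = 1\<close>, and whose error
  is therefore governed by \<open>Y(d\<^sub>0)\<^sup>2\<close> alone. If \<open>\<bar>X\<^sup>2 - 1\<bar> > Y(d\<^sub>0)\<^sup>2 / 2\<close> or \<open>Y\<^sup>2 > 2 Y(d\<^sub>0)\<^sup>2\<close>, then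
  \<open>d\<close> is worse than \<open>d\<^sub>0\<close>. The remaining parameters lie in a compact interval, so a minimiser exists,
  and on that interval \<open>\<psi>\<^sub>n(t, d)\<close> is strictly increasing in \<open>d\<close> for every \<open>\<bar>t\<bar> < 1\<close>. The midpoint of
  two minimisers would then have an error strictly between theirs at every interior \<open>t\<close>, hence
  a smaller maximum. Passing from \<open>\<psi>\<^sub>n\<close> to \<open>\<phi>\<^sub>n\<close> only composes with an increasing function.
\<close>


text \<open>
  The last condition says that equally large errors of either sign are weighted comparably; it makes
  the comparison with \<open>d\<^sub>0\<close> work for both error measures at once.
\<close>

definition error_scale :: "(real \<Rightarrow> real) \<Rightarrow> bool" where
  "error_scale h \<longleftrightarrow>
     continuous_on {-1..} h \<and> strict_mono_on {-1..} h \<and> h 0 = 0 \<and>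
     (\<forall>z\<in>{0..1/2}. h z \<le> - h (- z) \<and> - h (- z) \<le> h (2 * z))"

lemma error_scale_id: "error_scale (\<lambda>y. y)"
  unfolding error_scale_def by (auto intro!: strict_mono_onI)

text \<open>This scale turns \<open>simp_radial_error\<close> into \<open>radial_error\<close>. By
  concavity a negative error weighs more than a positive one of the same size, and doubling the
  positive one compensates for that. Both inequalities are obtained by squaring a sum of two
  roots.\<close>

lemma error_scale_sqrt: "error_scale (\<lambda>y. sqrt (1 + y) - 1)"
proof -
  have "sqrt (1 + z) - 1 \<le> - (sqrt (1 - z) - 1) \<and> - (sqrt (1 - z) - 1) \<le> sqrt (1 + 2 * z) - 1"
    if z: "0 \<le> z" "z \<le> 1/2" for z :: real
  proof
    have "(sqrt (1 + z) + sqrt (1 - z))\<^sup>2 = 2 + 2 * sqrt ((1 + z) * (1 - z))"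
      using z by (simp add: power2_sum real_sqrt_mult)
    also have "\<dots> \<le> 2\<^sup>2"
    proof -
      have "sqrt ((1 + z) * (1 - z)) \<le> sqrt 1"
        by (intro real_sqrt_le_mono) (simp add: algebra_simps)
      then show ?thesis by simp
    qed
    finally have "sqrt (1 + z) + sqrt (1 - z) \<le> 2"
      by (rule power2_le_imp_le) simp
    then show "sqrt (1 + z) - 1 \<le> - (sqrt (1 - z) - 1)" by simp
    have "2 - z \<le> 2 * sqrt ((1 + 2 * z) * (1 - z))"
    proof -
      \<comment> \<open>After squaring, the target amounts to \<open>9 * z * z \<le> 8 * z\<close>,
        hence the constant 8/9.\<close>
      have "z * z \<le> z * (8/9)" using z by (intro mult_left_mono) auto
      then have "((2 - z) / 2)\<^sup>2 \<le> (1 + 2 * z) * (1 - z)"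
        by (simp add: power2_eq_square field_simps)
      then have "(2 - z) / 2 \<le> sqrt ((1 + 2 * z) * (1 - z))"
        by (rule real_le_rsqrt)
      then show ?thesis by simp
    qed
    then have "2\<^sup>2 \<le> (sqrt (1 + 2 * z) + sqrt (1 - z))\<^sup>2"
      using z by (simp add: power2_sum real_sqrt_mult)
    then have "2 \<le> sqrt (1 + 2 * z) + sqrt (1 - z)"
      by (rule power2_le_imp_le) (use z in simp)
    then show "- (sqrt (1 - z) - 1) \<le> sqrt (1 + 2 * z) - 1" by simp
  qed
  then show ?thesis
    unfolding error_scale_def by (auto intro!: strict_mono_onI continuous_intros)
qed

section \<open>Elementary bounds and continuity of a supremum\<close>

text \<open>The bound is the value at the maximiser \<open>u = 1 / (m + 1)\<close>. Bernoulli's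
  inequality replaces calculus: \<open>v\<close> rescales \<open>1 - u\<close> so that the maximiser
  becomes \<open>v = 1\<close>, and Bernoulli at \<open>1 / v - 1\<close>, multiplied by
  \<open>v ^ (m + 1)\<close>, gives \<open>v ^ m * (m + 1 - m * v) \<le> 1\<close>.\<close>

lemma mult_power_one_minus_le:
  fixes u :: real
  assumes "0 \<le> u" "u \<le> 1"
  shows "u * (1 - u) ^ m \<le> (1 - 1 / (real m + 1)) ^ m / (real m + 1)"
proof (cases "m = 0 \<or> u = 1")
  case True
  then show ?thesis using assms by (cases m) auto
next
  case False
  then have m: "m > 0" and u: "u < 1" using assms by auto
  define v where "v = (1 - u) * (real m + 1) / m"
  have v: "v > 0" using u m by (simp add: v_def)
  have "1 + (m + 1) * (1 / v - 1) \<le> (1 + (1 / v - 1)) ^ (m + 1)"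
    using Bernoulli_inequality[of "1 / v - 1" "m + 1"] v by simp
  then have "v ^ (m + 1) * (1 + (m + 1) * (1 / v - 1)) \<le> v ^ (m + 1) * (1 / v) ^ (m + 1)"
    using v by (intro mult_left_mono) auto
  also have "\<dots> = 1" using v by (simp add: power_one_over)
  also have "v ^ (m + 1) * (1 + (m + 1) * (1 / v - 1)) = v ^ m * (real m + 1 - m * v)"
    using v by (simp add: field_simps)
  finally have *: "v ^ m * (real m + 1 - m * v) \<le> 1" .
  have e: "1 - 1 / (real m + 1) = real m / (real m + 1)" by (simp add: field_simps)
  have "1 - u = v * (1 - 1 / (real m + 1))"
    unfolding e v_def using m by simp
  then have 1: "(1 - u) ^ m = v ^ m * (1 - 1 / (real m + 1)) ^ m"
    by (simp only: power_mult_distrib)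
  have "m * v = (1 - u) * (real m + 1)"
    using m by (simp add: v_def)
  then have 2: "u = (real m + 1 - m * v) / (real m + 1)"
    by (simp add: field_simps)
  have "u * (1 - u) ^ m
      = (v ^ m * (real m + 1 - m * v)) * ((1 - 1 / (real m + 1)) ^ m / (real m + 1))"
    unfolding 1 by (subst 2) simp
  also have "\<dots> \<le> 1 * ((1 - 1 / (real m + 1)) ^ m / (real m + 1))"
    by (intro mult_right_mono *) auto
  finally show ?thesis by simp
qed

text \<open>The base is the reciprocal of \<open>1 + 1 / m\<close>, whose \<open>m\<close>-th power
  is at least 2 by Bernoulli.\<close>

lemma one_minus_inverse_power_le_half:
  assumes "m \<ge> 1"
  shows "(1 - 1 / (real m + 1)) ^ m \<le> 1 / 2"
proof -
  have "2 \<le> (1 + 1 / real m) ^ m"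
    using Bernoulli_inequality[of "1 / real m" m] assms
      by (simp add: order_trans[of "-1" 0])
  moreover have "1 - 1 / (real m + 1) = 1 / (1 + 1 / real m)"
    using assms by (simp add: field_simps)
  moreover have "1 / (1 + 1 / real m) ^ m \<le> 1 / 2"
    using calculation(1) by (intro divide_left_mono) auto
  ultimately show ?thesis
    by (simp only: power_one_over)
qed

text \<open>Compactness of \<open>C\<close> makes \<open>f d'\<close> uniformly close to
  \<open>f d\<close> on \<open>C\<close> once \<open>d'\<close> is near \<open>d\<close>, and
  uniformly close functions have close suprema. Applied to the maximal error as a function of the
  parameter, this yields a minimiser on a compact set.\<close>

lemma continuous_on_SUP_compact:
  fixes f :: "'a::topological_space \<Rightarrow> 'b::topological_space \<Rightarrow> real"
  assumes f: "continuous_on (J \<times> C) (\<lambda>(d, t). f d t)"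
    and C: "compact C" "C \<noteq> {}"
  shows "continuous_on J (\<lambda>d. SUP t\<in>C. f d t)"
  unfolding continuous_on_def tendsto_iff
proof (intro ballI allI impI)
  fix d and e :: real
  assume d: "d \<in> J" and e: "e > 0"
  have bdd: "bdd_above (f d' ` C)" if "d' \<in> J" for d'
  proof -
    have "continuous_on C (\<lambda>t. case (d', t) of (d, t) \<Rightarrow> f d t)"
      using that by (intro continuous_on_compose2[OF f] continuous_intros) auto
    then have "compact (f d' ` C)" by (intro compact_continuous_image C) simp
    then show ?thesis by (intro bounded_imp_bdd_above compact_imp_bounded)
  qed
  from continuous_on_prod_compactE[OF f C(1) d, of "e / 2"] e
  obtain U where U: "d \<in> U" "open U"
    and close: "\<forall>d'\<in>U \<inter> J. \<forall>t\<in>C. dist (f d' t) (f d t) \<le> e / 2"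
    by auto
  have "dist (SUP t\<in>C. f d' t) (SUP t\<in>C. f d t) < e" if d': "d' \<in> U" "d' \<in> J" for d'
  proof -
    have "(SUP t\<in>C. f d' t) \<le> (SUP t\<in>C. f d t) + e / 2"
    proof (rule cSUP_least[OF C(2)])
      fix t assume t: "t \<in> C"
      have "dist (f d' t) (f d t) \<le> e / 2" using close d' t by blast
      then have "f d' t \<le> f d t + e / 2" unfolding dist_real_def by linarith
      also have "f d t \<le> (SUP t\<in>C. f d t)" by (rule cSUP_upper[OF t bdd[OF d]])
      finally show "f d' t \<le> (SUP t\<in>C. f d t) + e / 2" by simp
    qed
    moreover have "(SUP t\<in>C. f d t) \<le> (SUP t\<in>C. f d' t) + e / 2"
    proof (rule cSUP_least[OF C(2)])
      fix t assume t: "t \<in> C"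
      have "dist (f d' t) (f d t) \<le> e / 2" using close d' t by blast
      then have "f d t \<le> f d' t + e / 2" unfolding dist_real_def by linarith
      also have "f d' t \<le> (SUP t\<in>C. f d' t)" by (rule cSUP_upper[OF t bdd[OF d'(2)]])
      finally show "f d t \<le> (SUP t\<in>C. f d' t) + e / 2" by simp
    qed
    ultimately show ?thesis using e by (simp add: dist_real_def abs_le_iff)
  qed
  then show "\<forall>\<^sub>F d' in at d within J.
      dist (SUP t\<in>C. f d' t) (SUP t\<in>C. f d t) < e"
    unfolding eventually_at_topological using U by blast
qed

section \<open>Existence and uniqueness from abstract conditions on X and Y\<close>

text \<open>Collects what the four degrees have in common. \<open>mono0\<close> and
  \<open>mono1\<close> concern the second factor of \<open>\<psi>\<close> at \<open>t = 0\<close>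
  and at \<open>t\<^sup>2 = 1\<close>; \<open>outside\<close> says that every parameter off
  \<open>J\<close> is visibly worse than \<open>d0\<close>; \<open>\<psi>_ge\<close> keeps the
  errors in the domain of \<open>h\<close>.\<close>

lemma unique_best_parameter:
  fixes h :: "real \<Rightarrow> real" and \<psi> :: "real \<Rightarrow> real \<Rightarrow> real" and X Y :: "real \<Rightarrow> real"
  assumes h: "error_scale h" and m: "m \<ge> 1" and \<sigma>: "\<sigma> = 1 \<or> \<sigma> = (-1::real)"
    and \<psi>: "\<And>t d. \<lbrakk>d \<in> D; t \<in> {-1..1}\<rbrakk> \<Longrightarrow>
          \<psi> t d = (1 - t\<^sup>2) ^ m * ((X d)\<^sup>2 - 1 + \<sigma> * (Y d)\<^sup>2 * t\<^sup>2)"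
    and \<psi>_ge: "\<And>t d. \<lbrakk>d \<in> D; t \<in> {-1..1}\<rbrakk> \<Longrightarrow> \<psi> t d \<ge> -1"
    and J: "J \<subseteq> D" "compact J" "convex J" "d0 \<in> J"
    and d0: "(X d0)\<^sup>2 = 1" "(Y d0)\<^sup>2 \<le> 2"
    and cont: "continuous_on J X" "continuous_on J Y"
    and mono0: "\<And>d d'. \<lbrakk>d \<in> J; d' \<in> J; d < d'\<rbrakk> \<Longrightarrow> (X d)\<^sup>2 < (X d')\<^sup>2"
    and mono1: "\<And>d d'. \<lbrakk>d \<in> J; d' \<in> J; d < d'\<rbrakk> \<Longrightarrow>
          (X d)\<^sup>2 + \<sigma> * (Y d)\<^sup>2 \<le> (X d')\<^sup>2 + \<sigma> * (Y d')\<^sup>2"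
    and outside: "\<And>d. \<lbrakk>d \<in> D; d \<notin> J\<rbrakk> \<Longrightarrow>
          (Y d0)\<^sup>2 < 2 * \<bar>(X d)\<^sup>2 - 1\<bar> \<or> 2 * (Y d0)\<^sup>2 < (Y d)\<^sup>2"
  shows "\<exists>!d. is_arg_min (\<lambda>d. max_abs (\<lambda>t. h (\<psi> t d))) (\<lambda>d. d \<in> D) d"
proof -
  define E where "E d = max_abs (\<lambda>t. h (\<psi> t d))" for d
  have h_cont: "continuous_on {-1..} h" and h_less: "\<And>x y. \<lbrakk>-1 \<le> x; x < y\<rbrakk> \<Longrightarrow> h x < h y"
    and h0: "h 0 = 0"
    and h_le1: "\<And>z. \<lbrakk>0 \<le> z; z \<le> 1/2\<rbrakk> \<Longrightarrow> h z \<le> - h (- z)"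
    and h_le2: "\<And>z. \<lbrakk>0 \<le> z; z \<le> 1/2\<rbrakk> \<Longrightarrow> - h (- z) \<le> h (2 * z)"
    using h by (auto simp: error_scale_def strict_mono_on_def)
  have h_le: "h x \<le> h y" if "-1 \<le> x" "x \<le> y" for x y
    using h_less[of x y] that by (cases "x = y") auto
  have t2: "t\<^sup>2 \<le> 1" if "t \<in> {-1..1}" for t :: real
    using that by (simp add: abs_le_iff abs_square_le_1)

  have cont_\<psi>: "continuous_on {-1..1} (\<lambda>t. h (\<psi> t d))" if "d \<in> D" for d
  proof -
    have "continuous_on {-1..1} (\<lambda>t. (1 - t\<^sup>2) ^ m * ((X d)\<^sup>2 - 1 + \<sigma> * (Y d)\<^sup>2 * t\<^sup>2))"
      by (intro continuous_intros)
    then have "continuous_on {-1..1} (\<lambda>t. \<psi> t d)"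
      by (rule continuous_on_eq) (simp add: \<psi> that)
    then show ?thesis
      by (rule continuous_on_compose2[OF h_cont]) (use \<psi>_ge that in auto)
  qed
  have E_attained: "\<exists>t\<in>{-1..1}. E d = \<bar>h (\<psi> t d)\<bar>" 
    and E_upper: "\<And>u. u \<in> {-1..1} \<Longrightarrow> \<bar>h (\<psi> u d)\<bar> \<le> E d" if "d \<in> D" for d
    using max_abs_attained[OF cont_\<psi>[OF that]] by (auto simp: E_def)

  \<comment> \<open>\<open>a\<close> is \<open>(1 - u) ^ m\<close> at the maximiser
    \<open>u = 1 / (m + 1)\<close> of \<open>u * (1 - u) ^ m\<close>, so \<open>w\<close> is the
    largest size of \<open>\<psi> t d0\<close>.\<close>
  define a :: real where "a = (1 - 1 / (real m + 1)) ^ m"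
  define w where "w = a / (real m + 1) * (Y d0)\<^sup>2"
  have a: "0 < a" "a \<le> 1/2"
    using one_minus_inverse_power_le_half[OF m] m by (auto simp: a_def field_simps)
  have a_div: "a / (real m + 1) \<le> 1/4" "0 < a / (real m + 1)"
  proof -
    have "a / (real m + 1) \<le> (1/2) / 2" using a m by (intro frac_le) auto
    then show "a / (real m + 1) \<le> 1/4" by simp
    show "0 < a / (real m + 1)" using a by simp
  qed
  have w: "0 \<le> w" "w \<le> (Y d0)\<^sup>2 / 4" "w \<le> 1/2"
  proof -
    show "0 \<le> w" using a by (simp add: w_def)
    show "w \<le> (Y d0)\<^sup>2 / 4"
      unfolding w_def using mult_right_mono[OF a_div(1), of "(Y d0)\<^sup>2"] by simp
    then show "w \<le> 1/2" using d0(2) by linarith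
  qed

  \<comment> \<open>All values \<open>\<psi> t d0\<close> lie on the side \<open>\<sigma>\<close> of
    zero. Errors on that side compare by monotonicity of \<open>h\<close> alone; for an error of
    either sign the weighting condition is needed, which costs the factor 2 in
    \<open>large\<close>.\<close>
  have same_sign: "\<bar>h z\<bar> < \<bar>h y\<bar>" if "0 \<le> \<sigma> * z" "\<sigma> * z < \<sigma> * y" "-1 \<le> y" for y z
    using \<sigma>
  proof
    assume "\<sigma> = 1"
    then show ?thesis using that h_le[of 0 z] h_less[of z y] h0 by auto
  next
    assume "\<sigma> = -1"
    then show ?thesis using that h_le[of z 0] h_less[of y z] h0 by auto
  qed
  have same_sign_le: "\<bar>h z\<bar> \<le> \<bar>h y\<bar>" if "0 \<le> \<sigma> * z" "\<sigma> * z \<le> \<sigma> * y" "-1 \<le> y" for y z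
    using \<sigma> same_sign[OF that(1) _ that(3)] that by (cases "\<sigma> * z = \<sigma> * y") auto
  have large: "\<bar>h (\<sigma> * w)\<bar> < \<bar>h y\<bar>" if "2 * w < \<bar>y\<bar>" "-1 \<le> y" for y
  proof -
    have "\<bar>h (\<sigma> * w)\<bar> \<le> - h (- w)"
      using \<sigma> h_le1[of w] h_le[of 0 w] h_le[of "-w" 0] h0 w by auto
    also have "\<dots> < \<bar>h y\<bar>"
    proof (cases "y \<ge> 0")
      case True
      then have "- h (- w) < h y"
        using h_le2[of w] h_less[of "2 * w" y] w that by auto
      then show ?thesis by simp
    next
      case False
      then have "h y < h (- w)" using h_less[of y "- w"] w that by auto
      then show ?thesis by simp
    qed
    finally show ?thesis .
  qed

  have E_d0: "E d0 \<le> \<bar>h (\<sigma> * w)\<bar>"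
  proof -
    have d0_D: "d0 \<in> D" using J by auto
    obtain t where t: "t \<in> {-1..1}" "E d0 = \<bar>h (\<psi> t d0)\<bar>"
      using E_attained[OF d0_D] by auto
    have \<psi>_d0: "\<sigma> * \<psi> t d0 = (t\<^sup>2 * (1 - t\<^sup>2) ^ m) * (Y d0)\<^sup>2"
      using \<sigma> d0 by (auto simp: \<psi>[OF d0_D t(1)])
    have "\<sigma> * \<psi> t d0 \<le> w"
      unfolding \<psi>_d0 w_def a_def
      by (intro mult_right_mono mult_power_one_minus_le t2 t) auto
    moreover have "0 \<le> \<sigma> * \<psi> t d0"
      unfolding \<psi>_d0 using t2[OF t(1)] by simp
    ultimately show ?thesis
      unfolding t(2) using \<sigma> w by (intro same_sign_le) auto
  qed

  have E_outside: "E d0 < E d" if d: "d \<in> D" "d \<notin> J" for d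
  proof -
    have "\<exists>t\<in>{-1..1}. \<bar>h (\<sigma> * w)\<bar> < \<bar>h (\<psi> t d)\<bar>"
    proof (cases "2 * w < \<bar>(X d)\<^sup>2 - 1\<bar>")
      case True
      have "\<psi> 0 d = (X d)\<^sup>2 - 1" using \<psi>[OF d(1), of 0] by simp
      with True show ?thesis
        by (intro bexI[of _ 0] large) auto
    next
      case False
      \<comment> \<open>As \<open>w \<le> (Y d0)\<^sup>2 / 4\<close>, the first alternative of
        \<open>outside\<close> is ruled out. The second is tested where
        \<open>u * (1 - u) ^ m\<close> peaks: there the \<open>Y\<close> term exceeds
        \<open>2 * w\<close>, while the \<open>X\<close> term takes away at most
        \<open>a * (2 * w) \<le> w\<close>.\<close>
      then have Y: "2 * (Y d0)\<^sup>2 < (Y d)\<^sup>2" using outside[OF d] w by auto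
      define t where "t = sqrt (1 / (real m + 1))"
      have t: "t \<in> {-1..1}" "t\<^sup>2 = 1 / (real m + 1)"
      proof -
        have "0 \<le> t" "t \<le> 1" by (simp_all add: t_def)
        then show "t \<in> {-1..1}" by simp
      qed (simp add: t_def)
      have "\<psi> t d = a * ((X d)\<^sup>2 - 1) + \<sigma> * (a / (real m + 1) * (Y d)\<^sup>2)"
        unfolding \<psi>[OF d(1) t(1)] t(2) a_def by (simp add: algebra_simps)
      then have eq: "\<sigma> * \<psi> t d = a * (\<sigma> * ((X d)\<^sup>2 - 1)) + a / (real m + 1) * (Y d)\<^sup>2"
        using \<sigma> by (auto simp: algebra_simps)
      have "a / (real m + 1) * (2 * (Y d0)\<^sup>2) < a / (real m + 1) * (Y d)\<^sup>2"
        by (rule mult_strict_left_mono[OF Y a_div(2)])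
      then have 1: "2 * w < a / (real m + 1) * (Y d)\<^sup>2"
        unfolding w_def by (simp only: mult.left_commute[of 2])
      have "- (2 * w) \<le> \<sigma> * ((X d)\<^sup>2 - 1)"
        using \<sigma> by (rule disjE) (use False in \<open>simp_all add: abs_if split: if_splits\<close>)
      then have "a * (- (2 * w)) \<le> a * (\<sigma> * ((X d)\<^sup>2 - 1))"
        by (rule mult_left_mono) (use a in simp)
      moreover have "a * (2 * w) \<le> 1/2 * (2 * w)"
        by (rule mult_right_mono) (use a w in simp_all)
      ultimately have "w < \<sigma> * \<psi> t d" using 1 unfolding eq by linarith
      moreover have "\<sigma> * (\<sigma> * w) = w" using \<sigma> by auto
      ultimately have "\<bar>h (\<sigma> * w)\<bar> < \<bar>h (\<psi> t d)\<bar>"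
        using w(1) \<psi>_ge[OF d(1) t(1)] by (intro same_sign) (simp_all only:)
      then show ?thesis using t(1) by blast
    qed
    then obtain t where "t \<in> {-1..1}" "\<bar>h (\<sigma> * w)\<bar> < \<bar>h (\<psi> t d)\<bar>" by blast
    then show ?thesis using E_d0 E_upper[OF d(1), of t] by linarith
  qed

  have "continuous_on J E"
  proof -
    have "continuous_on (J \<times> {-1..1}) (\<lambda>(d, t). \<bar>h (\<psi> t d)\<bar>)"
    proof -
      have "continuous_on (J \<times> {-1..1}) (\<lambda>z. (1 - (snd z)\<^sup>2) ^ m *
          ((X (fst z))\<^sup>2 - 1 + \<sigma> * (Y (fst z))\<^sup>2 * (snd z)\<^sup>2))"
        by (intro continuous_intros continuous_on_compose2[OF cont(1)]
            continuous_on_compose2[OF cont(2)]) auto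
      then have "continuous_on (J \<times> {-1..1}) (\<lambda>z. \<psi> (snd z) (fst z))"
        by (rule continuous_on_eq) (use J(1) in \<open>auto simp: \<psi> subset_iff\<close>)
      then have "continuous_on (J \<times> {-1..1}) (\<lambda>z. \<bar>h (\<psi> (snd z) (fst z))\<bar>)"
        by (intro continuous_intros continuous_on_compose2[OF h_cont])
          (use J(1) \<psi>_ge in \<open>auto simp: subset_iff\<close>)
      then show ?thesis by (simp add: case_prod_beta)
    qed
    from continuous_on_SUP_compact[OF this] show ?thesis
      by (simp add: E_def max_abs_def)
  qed
  then obtain d1 where d1: "d1 \<in> J" and d1_min: "\<And>d. d \<in> J \<Longrightarrow> E d1 \<le> E d"
    using continuous_attains_inf[of J E] J by blast
  have d1_le: "E d1 \<le> E d" if "d \<in> D" for d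
    using d1_min[OF J(4)] d1_min[of d] E_outside[of d] that by fastforce
  have min_in_J: "d \<in> J" if "d \<in> D" "E d \<le> E d0" for d
    using E_outside[of d] that by fastforce

  have no_two: False if d: "d \<in> J" "d' \<in> J" "d < d'" "E d \<le> E d1" "E d' \<le> E d1" for d d'
  proof -
    define e where "e = (d + d') / 2"
    have "(1/2) *\<^sub>R d + (1/2) *\<^sub>R d' \<in> J"
      by (rule convexD[OF J(3) d(1,2)]) simp_all
    then have "e \<in> J" by (simp add: e_def add_divide_distrib)
    then have e: "e \<in> J" "d < e" "e < d'" using d(3) by (simp_all add: e_def)
    have less: "\<psi> t x < \<psi> t y" if xy: "x \<in> J" "y \<in> J" "x < y" and t: "t\<^sup>2 < 1" for t x y
    proof -
      have t1: "t \<in> {-1..1}" using t by (simp add: abs_square_less_1 abs_le_iff abs_less_iff)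
      \<comment> \<open>Up to the constant -1, the second factor of \<open>\<psi>\<close> is the
        convex combination of its values at \<open>t = 0\<close> and \<open>t\<^sup>2 = 1\<close>
        with weights \<open>1 - t\<^sup>2\<close> and \<open>t\<^sup>2\<close>. The first weight is
        positive, so strictness at \<open>t = 0\<close> suffices.\<close>
      have "(1 - t\<^sup>2) * (X x)\<^sup>2 + t\<^sup>2 * ((X x)\<^sup>2 + \<sigma> * (Y x)\<^sup>2)
          < (1 - t\<^sup>2) * (X y)\<^sup>2 + t\<^sup>2 * ((X y)\<^sup>2 + \<sigma> * (Y y)\<^sup>2)"
        using mono0[OF xy] mono1[OF xy] t
        by (intro add_less_le_mono mult_strict_left_mono mult_left_mono) auto
      then have "(X x)\<^sup>2 - 1 + \<sigma> * (Y x)\<^sup>2 * t\<^sup>2 < (X y)\<^sup>2 - 1 + \<sigma> * (Y y)\<^sup>2 * t\<^sup>2"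
        by (simp add: algebra_simps)
      then show ?thesis
        using t xy J(1) by (subst (1 2) \<psi>) (auto intro!: mult_strict_left_mono simp: t1[simplified])
    qed
    have D: "d \<in> D" "d' \<in> D" "e \<in> D" using d e J(1) by auto
    have between: "\<bar>h (\<psi> t e)\<bar> < E d1" if "t\<^sup>2 < 1" for t
    proof -
      have t: "t \<in> {-1..1}" using that by (simp add: abs_square_less_1 abs_le_iff abs_less_iff)
      have "h (\<psi> t d) < h (\<psi> t e)" "h (\<psi> t e) < h (\<psi> t d')"
        using less[OF d(1) e(1,2) that] less[OF e(1) d(2) e(3) that] \<psi>_ge[OF _ t] D
        by (auto intro!: h_less)
      moreover have "\<bar>h (\<psi> t d)\<bar> \<le> E d1" "\<bar>h (\<psi> t d')\<bar> \<le> E d1"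
        using E_upper[OF D(1) t] E_upper[OF D(2) t] d by auto
      ultimately show ?thesis by auto
    qed
    obtain t where t: "t \<in> {-1..1}" "E e = \<bar>h (\<psi> t e)\<bar>"
      using E_attained[OF D(3)] by auto
    have "E e < E d1"
    proof (cases "t\<^sup>2 < 1")
      case True
      then show ?thesis using between t by simp
    next
      \<comment> \<open>At the end points the error vanishes. That \<open>E d1\<close> is positive
        is seen at the interior point 0.\<close>
      case False
      then have "t\<^sup>2 = 1" using t2[OF t(1)] by simp
      then have "\<psi> t e = 0" using m by (simp add: \<psi>[OF D(3) t(1)] power_0_left)
      then have "E e = 0" using h0 t(2) by simp
      moreover have "\<bar>h (\<psi> 0 e)\<bar> < E d1" by (rule between) simp
      ultimately show ?thesis by linarith
    qed
    then show False using d1_le[OF D(3)] by linarith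
  qed

  have "is_arg_min E (\<lambda>d. d \<in> D) d1"
    using d1 J(1) d1_le by (auto simp: is_arg_min_linorder)
  moreover have "d = d1" if "is_arg_min E (\<lambda>d. d \<in> D) d" for d
  proof -
    have d: "d \<in> D" "E d \<le> E d1" 
      using that d1 J(1) by (auto simp: is_arg_min_linorder)
    moreover have "E d1 \<le> E d0" by (rule d1_min[OF J(4)])
    ultimately have "d \<in> J" by (intro min_in_J) linarith+
    then show ?thesis
      using no_two[of d d1] no_two[of d1 d] d1 d(2) by (metis linorder_less_linear order_refl)
  qed
  ultimately show ?thesis unfolding E_def by blast
qed

subsection \<open>Factorisation of the simplified radial error\<close>

text \<open>With \<open>a - b = c\<close> the curve is \<open>(a - b * t\<^sup>2, t * s)\<close>.
  Its end points lie on the unit circle, which produces the factor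
  \<open>1 - t\<^sup>2\<close>.\<close>

lemma simp_radial_error_2:
  fixes \<phi> d t :: real
  defines "c \<equiv> cos \<phi>"
  shows "simp_radial_error \<phi> 2 t d
    = (1 - t\<^sup>2) ^ 1 * (((c + d) / 2)\<^sup>2 - 1 + (-1) * ((d - c) / 2)\<^sup>2 * t\<^sup>2)"
proof -
  define s where "s = sin \<phi>"
  define a b where "a = (c + d) / 2" and "b = (d - c) / 2"
  have cs: "(a - b)\<^sup>2 + s\<^sup>2 = 1" by (simp add: a_def b_def c_def s_def field_simps)
  have "interpolant \<phi> 2 t d = (a - b * t\<^sup>2, t * s)"
    unfolding interpolant_def
    by (simp add: ctrl_point_def half_ctrl_def bernstein_poly_def reflect_x_def eval_nat_numeral
        sum.atLeast0_atMost_Suc c_def[symmetric] s_def[symmetric] Let_def)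
      (simp add: a_def b_def field_simps power2_eq_square)
  then have "simp_radial_error \<phi> 2 t d = (a - b * t\<^sup>2)\<^sup>2 + (t * s)\<^sup>2 - 1"
    by (simp add: simp_radial_error_def norm_Pair)
  also have "\<dots> = (1 - t\<^sup>2) * (a\<^sup>2 - 1 - b\<^sup>2 * t\<^sup>2)"
    using cs by algebra
  finally show ?thesis by (simp add: a_def b_def)
qed

lemma simp_radial_error_3:
  fixes \<phi> d t :: real
  defines "c \<equiv> cos \<phi>" and "s \<equiv> sin \<phi>"
  shows "simp_radial_error \<phi> 3 t d
    = (1 - t\<^sup>2) ^ 2 * ((c + 3 / 4 * d * s)\<^sup>2 - 1 + 1 * (3 / 4 * d * c - s / 2)\<^sup>2 * t\<^sup>2)"
proof -
  have cs: "c\<^sup>2 + s\<^sup>2 = 1" by (simp add: c_def s_def)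
  have "interpolant \<phi> 3 t d = (c + 3 / 4 * d * s * (1 - t\<^sup>2),
      t * (s * (3 - t\<^sup>2) / 2 - 3 / 4 * d * c * (1 - t\<^sup>2)))"
    unfolding interpolant_def
    by (simp add: ctrl_point_def half_ctrl_def bernstein_poly_def reflect_x_def eval_nat_numeral
        sum.atLeast0_atMost_Suc c_def[symmetric] s_def[symmetric] Let_def) (simp add: field_simps)
  then have "simp_radial_error \<phi> 3 t d
      = (c + 3 / 4 * d * s * (1 - t\<^sup>2))\<^sup>2 
         + (t * (s * (3 - t\<^sup>2) / 2 - 3 / 4 * d * c * (1 - t\<^sup>2)))\<^sup>2 - 1"
    by (simp add: simp_radial_error_def norm_Pair)
  also have "\<dots> = (1 - t\<^sup>2) ^ 2 * ((c + 3 / 4 * d * s)\<^sup>2 - 1 + 1 * (3 / 4 * d * c - s / 2)\<^sup>2 * t\<^sup>2)"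
    using cs by algebra
  finally show ?thesis .
qed

text \<open>The root in \<open>r\<close> enters only through
  \<open>4 * r\<^sup>2 = 3 - 3 * c * d\<close>, the curvature condition at the end points. Together
  with \<open>c\<^sup>2 + s\<^sup>2 = 1\<close> it turns the factorisation into a polynomial
  identity.\<close>

lemma simp_radial_error_4:
  fixes \<phi> d t :: real
  defines "c \<equiv> cos \<phi>" and "s \<equiv> sin \<phi>"
  defines "r \<equiv> sqrt 3 / 2 * sqrt (1 - c * d)"
  assumes d: "c * d \<le> 1"
  shows "simp_radial_error \<phi> 4 t d = (1 - t\<^sup>2) ^ 3 *
    (((5 * c + 4 * r * s + 3 * d) / 8)\<^sup>2 - 1 + (-1) * ((3 * d - 3 * c - 4 * r * s) / 8)\<^sup>2 * t\<^sup>2)"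
proof -
  have cs: "c\<^sup>2 + s\<^sup>2 = 1" by (simp add: c_def s_def)
  have r: "4 * r\<^sup>2 = 3 - 3 * c * d"
    using d by (simp add: r_def power_mult_distrib power_divide)
  have ctrl: "half_ctrl \<phi> 4 d = [(c, - s), (c, - s) + r *\<^sub>R (s, c), (d, 0)]"
    by (simp add: half_ctrl_def Let_def r_def c_def s_def)
  define X K where "X = (5 * c + 4 * r * s + 3 * d) / 8" and "K = (3 * d - 3 * c - 4 * r * s) / 8"
  have XK: "8 * X = 5 * c + 4 * r * s + 3 * d" "8 * K = 3 * d - 3 * c - 4 * r * s"
    by (simp_all add: X_def K_def)
  have "interpolant \<phi> 4 t d = (X + 3 / 4 * (c - d) * t\<^sup>2 + K * t ^ 4,
      t * (1 / 2 * s * (3 - t\<^sup>2) - r * c * (1 - t\<^sup>2)))"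
    unfolding interpolant_def
    using ctrl by (simp add: ctrl_point_def bernstein_poly_def reflect_x_def eval_nat_numeral
        sum.atLeast0_atMost_Suc)
      (simp add: X_def K_def field_simps power2_eq_square power4_eq_xxxx)
  then have "simp_radial_error \<phi> 4 t d = (X + 3 / 4 * (c - d) * t\<^sup>2 + K * t ^ 4)\<^sup>2
        + (t * (1 / 2 * s * (3 - t\<^sup>2) - r * c * (1 - t\<^sup>2)))\<^sup>2 - 1"
    by (simp add: simp_radial_error_def norm_Pair)
  also have "\<dots> = (1 - t\<^sup>2) ^ 3 * (X\<^sup>2 - 1 - K\<^sup>2 * t\<^sup>2)"
    using cs r XK by algebra
  finally show ?thesis by (simp add: X_def K_def)
qed

text \<open>The curve is expanded in \<open>v = 1 - t\<^sup>2\<close>. Facts 1 to 3 of the proof say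
  that the coefficients of \<open>v\<close>, \<open>v\<^sup>2\<close> and \<open>v ^ 3\<close> in
  the squared norm minus 1 vanish; the constant one vanishes by
  \<open>c\<^sup>2 + s\<^sup>2 = 1\<close>.\<close>

lemma simp_radial_error_5:
  fixes \<phi> d t :: real
  defines "c \<equiv> cos \<phi>" and "s \<equiv> sin \<phi>"
  defines "w \<equiv> 5 * d + 2 * s * c"
  defines "B \<equiv> (5 * d * (4 - 5 * d\<^sup>2) * c + 4 * (2 + 5 * d\<^sup>2) * s) / (4 * w)"
    and "C \<equiv> 5 * d * ((4 - 5 * d\<^sup>2) * s - 6 * d * c) / (4 * w)"
  assumes w: "w \<noteq> 0"
  shows "simp_radial_error \<phi> 5 t d = (1 - t\<^sup>2) ^ 4 *
    (((6 * c + 5 * d * s + 10 * B) / 16)\<^sup>2 - 1 + 1 * ((5 * d * c - 4 * s + 10 * C) / 16)\<^sup>2 * t\<^sup>2)"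
proof -
  have cs: "c\<^sup>2 + s\<^sup>2 = 1" by (simp add: c_def s_def)
  have B: "4 * w * B = 5 * d * (4 - 5 * d\<^sup>2) * c + 4 * (2 + 5 * d\<^sup>2) * s"
    and C: "4 * w * C = 5 * d * ((4 - 5 * d\<^sup>2) * s - 6 * d * c)"
    using w by (simp_all add: B_def C_def)
  have ctrl: "half_ctrl \<phi> 5 d = [(c, - s), (c, - s) + d *\<^sub>R (s, c), (B, - C)]"
    by (simp add: half_ctrl_def Let_def B_def C_def c_def s_def w_def)
  define v where "v = 1 - t\<^sup>2"
  define a1 where "a1 = 5 / 4 * d * s"
  define a2 where "a2 = (10 * c - 30 * (c + d * s) + 20 * B) / 32"
  define b1 where "b1 = s / 2 - 5 / 4 * c * d"
  define L where "L = (5 * d * c - 4 * s + 10 * C) / 16"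
  have "interpolant \<phi> 5 t d = (c + a1 * v + a2 * v\<^sup>2, t * (s + b1 * v + L * v\<^sup>2))"
    unfolding interpolant_def
    using ctrl by (simp add: ctrl_point_def bernstein_poly_def reflect_x_def eval_nat_numeral
        sum.atLeast0_atMost_Suc)
      (simp add: v_def a1_def a2_def b1_def L_def field_simps power2_eq_square power4_eq_xxxx)
  then have eq: "simp_radial_error \<phi> 5 t d
      = (c + a1 * v + a2 * v\<^sup>2)\<^sup>2 + (t * (s + b1 * v + L * v\<^sup>2))\<^sup>2 - 1"
    by (simp add: simp_radial_error_def norm_Pair)
  have w_eq: "w = 5 * d + 2 * s * c" by (simp add: w_def)
  have eqs: "4 * a1 = 5 * d * s" "32 * a2 = 10 * c - 30 * (c + d * s) + 20 * B"
    "4 * b1 = 2 * s - 5 * c * d" "16 * L = 5 * d * c - 4 * s + 10 * C"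
    by (simp_all add: a1_def a2_def b1_def L_def)
  have 1: "2 * c * a1 + 2 * s * b1 = s\<^sup>2"
    using eqs by algebra
  \<comment> \<open>Multiplying by \<open>w\<close> clears the common denominator of
    \<open>B\<close> and \<open>C\<close>, so that only polynomial relations are involved.\<close>
  have "w * (a1\<^sup>2 + 2 * c * a2 + b1\<^sup>2 + 2 * s * L) = w * (2 * s * b1)"
    using B C cs w_eq eqs by algebra
  then have 2: "a1\<^sup>2 + 2 * c * a2 + b1\<^sup>2 + 2 * s * L = 2 * s * b1"
    using w by simp
  have "w * (2 * a1 * a2 + 2 * b1 * L) = w * (b1\<^sup>2 + 2 * s * L)"
    using B C cs w_eq eqs by algebra
  then have 3: "2 * a1 * a2 + 2 * b1 * L = b1\<^sup>2 + 2 * s * L"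
    using w by simp
  have v: "t\<^sup>2 = 1 - v" by (simp add: v_def)
  have "(c + a1 * v + a2 * v\<^sup>2)\<^sup>2 + (t * (s + b1 * v + L * v\<^sup>2))\<^sup>2 - 1
      = v ^ 4 * ((c + a1 + a2)\<^sup>2 - 1 + L\<^sup>2 * t\<^sup>2)"
    using 1 2 3 cs v by algebra
  also have "c + a1 + a2 = (6 * c + 5 * d * s + 10 * B) / 16"
    by (simp add: a1_def a2_def field_simps)
  finally show ?thesis unfolding eq by (simp add: v_def L_def)
qed

lemma simp_radial_error_ge: "simp_radial_error \<phi> n t d \<ge> -1"
  by (simp add: simp_radial_error_def)

lemma cos_sin_half_period:
  fixes \<phi> :: real
  assumes "0 < \<phi>" "\<phi> \<le> pi / 2"
  shows "0 \<le> cos \<phi>" "cos \<phi> < 1" "0 < sin \<phi>" "(sin \<phi>)\<^sup>2 = (1 - cos \<phi>) * (1 + cos \<phi>)"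
proof -
  show "0 \<le> cos \<phi>" "0 < sin \<phi>" using assms by (auto intro: cos_ge_zero sin_gt_zero)
  show "cos \<phi> < 1" using cos_monotone_0_pi[of 0 \<phi>] assms by simp
  show "(sin \<phi>)\<^sup>2 = (1 - cos \<phi>) * (1 + cos \<phi>)"
    by (simp add: sin_squared_eq power2_eq_square algebra_simps)
qed

subsection \<open>Quadratic and cubic interpolants\<close>

lemma unique_best_2:
  fixes \<phi> :: real
  assumes \<phi>: "0 < \<phi>" "\<phi> \<le> pi / 2" and h: "error_scale h"
  shows "\<exists>!d. is_arg_min (\<lambda>d. max_abs (\<lambda>t. h (simp_radial_error \<phi> 2 t d)))
    (\<lambda>d. d \<in> admissible \<phi> 2) d"
proof -
  define c where "c = cos \<phi>"
  define k where "k = 1 - c"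
  have c: "0 \<le> c" and k: "0 < k" "k \<le> 1" and ck: "c = 1 - k"
    using cos_sin_half_period[OF \<phi>] by (simp_all add: c_def k_def)
  have kk: "k\<^sup>2 \<le> k" using k by (simp add: power2_eq_square mult_le_cancel_left1)
  define X Y where "X d = (c + d) / 2" and "Y d = (d - c) / 2" for d
  \<comment> \<open>At \<open>1 + k\<close> one has \<open>X = 1\<close> and \<open>Y = k\<close>.
    At the ends of \<open>J\<close>, \<open>X\<close> equals \<open>1 - 2/5 * k\<close> and
    \<open>1 + k\<close>, so \<open>X\<close> alone rejects every admissible parameter
    outside.\<close>
  define J where "J = {1 + k / 5..1 + 3 * k}"
  show ?thesis
  proof (rule unique_best_parameter[where h = h and \<psi> = "simp_radial_error \<phi> 2" and X = X and Y = Y and m = 1 and \<sigma> = "-1"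
        and J = J and ?d0.0 = "1 + k"])
    show "simp_radial_error \<phi> 2 t d = (1 - t\<^sup>2) ^ 1 * ((X d)\<^sup>2 - 1 + (-1) * (Y d)\<^sup>2 * t\<^sup>2)" for t d
      unfolding simp_radial_error_2 by (simp add: X_def Y_def c_def)
    show "J \<subseteq> admissible \<phi> 2" using k by (auto simp: J_def admissible_def)
    show "(X d)\<^sup>2 < (X d')\<^sup>2" if "d \<in> J" "d < d'" for d d'
      using that c k by (intro power_strict_mono) (auto simp: X_def J_def)
    show "(X d)\<^sup>2 + (-1) * (Y d)\<^sup>2 \<le> (X d')\<^sup>2 + (-1) * (Y d')\<^sup>2" if "d < d'" for d d'
    proof -
      \<comment> \<open>This product is constant in \<open>d\<close> when \<open>c = 0\<close>, so
        the monotonicity at \<open>t\<^sup>2 = 1\<close> is only weak.\<close>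
      have "(X d)\<^sup>2 + (-1) * (Y d)\<^sup>2 = c * d" for d
        by (simp add: X_def Y_def power2_eq_square field_simps)
      then show ?thesis using that c by (simp add: mult_left_mono)
    qed
    show "(Y (1 + k))\<^sup>2 < 2 * \<bar>(X d)\<^sup>2 - 1\<bar> \<or> 2 * (Y (1 + k))\<^sup>2 < (Y d)\<^sup>2"
      if "d \<in> admissible \<phi> 2" "d \<notin> J" for d
    proof (cases "d < 1 + k / 5")
      case True
      have "(X d)\<^sup>2 < (1 - 2/5 * k)\<^sup>2"
        using True that c by (intro power_strict_mono) (auto simp: X_def ck admissible_def)
      then have "(X d)\<^sup>2 < 1 - 4/5 * k + 4/25 * k\<^sup>2"
        by (simp add: power2_eq_square algebra_simps)
      then have "k\<^sup>2 < 2 * (1 - (X d)\<^sup>2)" using kk k by argo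
      then have "k\<^sup>2 < 2 * \<bar>(X d)\<^sup>2 - 1\<bar>"
        using abs_ge_minus_self[of "(X d)\<^sup>2 - 1"] by argo
      then show ?thesis by (simp add: Y_def ck)
    next
      case False
      then have "(1 + k)\<^sup>2 < (X d)\<^sup>2"
        using that k by (intro power_strict_mono) (auto simp: X_def ck J_def)
      then have "1 + 2 * k + k\<^sup>2 < (X d)\<^sup>2"
        by (simp add: power2_eq_square algebra_simps)
      then have "k\<^sup>2 < 2 * \<bar>(X d)\<^sup>2 - 1\<bar>"
        using kk k abs_ge_self[of "(X d)\<^sup>2 - 1"] by argo
      then show ?thesis by (simp add: Y_def ck)
    qed
    show "(Y (1 + k))\<^sup>2 \<le> 2" using kk k by (simp add: Y_def ck)
  qed (use k h in \<open>auto simp: simp_radial_error_ge X_def Y_def J_def ck intro!: continuous_intros\<close>)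
qed

lemma unique_best_3:
  fixes \<phi> :: real
  assumes \<phi>: "0 < \<phi>" "\<phi> \<le> pi / 2" and h: "error_scale h"
  shows "\<exists>!d. is_arg_min (\<lambda>d. max_abs (\<lambda>t. h (simp_radial_error \<phi> 3 t d)))
    (\<lambda>d. d \<in> admissible \<phi> 3) d"
proof -
  define c s where "c = cos \<phi>" and "s = sin \<phi>"
  define k where "k = 1 - c"
  have c: "0 \<le> c" and s: "0 < s" and k: "0 < k" "k \<le> 1" and ck: "c = 1 - k" and s2: "s\<^sup>2 = k * (1 + c)"
    using cos_sin_half_period[OF \<phi>] by (simp_all add: c_def s_def k_def)
  have kk: "k\<^sup>2 \<le> k" using k by (simp add: power2_eq_square mult_le_cancel_left1)
  define X Y where "X d = c + 3 / 4 * d * s" and "Y d = 3 / 4 * d * c - s / 2" for d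
  define d0 where "d0 = 4 * k / (3 * s)"
  \<comment> \<open>\<open>d0\<close> solves \<open>X d = 1\<close>. Half and twice this value put
    \<open>X\<close> at \<open>1 - k / 2\<close> and \<open>1 + k\<close>.\<close>
  have d0: "0 < d0" "d0 * s = 4 / 3 * k" using k s by (simp_all add: d0_def)
  define J where "J = {d0 / 2..2 * d0}"
  have X_d0: "X d0 = 1" using d0(2) by (simp add: X_def ck)
  \<comment> \<open>The outcome is \<open>Y d0 = - k\<^sup>2 / (2 * s)\<close>. With
    \<open>s\<^sup>2 = k * (1 + c)\<close> the square is of order \<open>k ^ 3\<close>, whereas
    \<open>X\<^sup>2 - 1\<close> is of order \<open>k\<close> at the ends of
    \<open>J\<close>.\<close>
  have "2 * s * Y d0 = 3 / 2 * (d0 * s) * c - s\<^sup>2"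
    by (simp add: Y_def power2_eq_square algebra_simps)
  also have "\<dots> = - k\<^sup>2" unfolding d0(2) s2 by (simp add: ck power2_eq_square algebra_simps)
  finally have "4 * s\<^sup>2 * (Y d0)\<^sup>2 = k\<^sup>2 * k\<^sup>2"
    by (metis (no_types, lifting) power_mult_distrib power2_minus power2_eq_square mult_minus_left
        mult_minus_right four_x_squared minus_minus)
  then have "k * (4 * (1 + c) * (Y d0)\<^sup>2) = k * (k * k\<^sup>2)"
    unfolding s2 by (simp only: power2_eq_square ac_simps)
  then have "4 * (1 + c) * (Y d0)\<^sup>2 = k * k\<^sup>2" using k by simp
  moreover have "4 * 1 * (Y d0)\<^sup>2 \<le> 4 * (1 + c) * (Y d0)\<^sup>2"
    using c by (intro mult_right_mono) auto
  moreover have "k * k\<^sup>2 \<le> 1 * k" using k kk by (intro mult_mono) auto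
  ultimately have Y_d0: "4 * (Y d0)\<^sup>2 \<le> k" by simp
  show ?thesis
  proof (rule unique_best_parameter[where h = h and \<psi> = "simp_radial_error \<phi> 3" and X = X and Y = Y and m = 2 and \<sigma> = "1"
        and J = J and ?d0.0 = d0])
    show "simp_radial_error \<phi> 3 t d = (1 - t\<^sup>2) ^ 2 * ((X d)\<^sup>2 - 1 + 1 * (Y d)\<^sup>2 * t\<^sup>2)" for t d
      unfolding simp_radial_error_3 by (simp add: X_def Y_def c_def s_def)
    show "J \<subseteq> admissible \<phi> 3" using d0 by (auto simp: J_def admissible_def)
    show "(X d)\<^sup>2 < (X d')\<^sup>2" if "d \<in> J" "d < d'" for d d'
      using that c s d0 by (intro power_strict_mono) (auto simp: X_def J_def intro!: add_nonneg_nonneg)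
    show "(X d)\<^sup>2 + 1 * (Y d)\<^sup>2 \<le> (X d')\<^sup>2 + 1 * (Y d')\<^sup>2" if "d \<in> J" "d < d'" for d d'
    proof -
      have eq: "(X d)\<^sup>2 + 1 * (Y d)\<^sup>2
          = c\<^sup>2 + s\<^sup>2 / 4 + 9 / 16 * (d\<^sup>2 * (c\<^sup>2 + s\<^sup>2)) + 3 / 4 * (c * s * d)" for d
        by (simp add: X_def Y_def power2_eq_square field_simps)
      have "d\<^sup>2 * (c\<^sup>2 + s\<^sup>2) \<le> d'\<^sup>2 * (c\<^sup>2 + s\<^sup>2)" "c * s * d \<le> c * s * d'"
        using that d0 c s by (auto simp: J_def intro!: mult_right_mono mult_left_mono power_mono)
      then show ?thesis unfolding eq by linarith
    qed
    show "(Y d0)\<^sup>2 < 2 * \<bar>(X d)\<^sup>2 - 1\<bar> \<or> 2 * (Y d0)\<^sup>2 < (Y d)\<^sup>2"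
      if "d \<in> admissible \<phi> 3" "d \<notin> J" for d
    proof (cases "d < d0 / 2")
      case True
      then have "d * s < d0 / 2 * s" using s by (intro mult_strict_right_mono) auto
      moreover have "0 \<le> d * s" using that s by (auto simp: admissible_def)
      ultimately have "(X d)\<^sup>2 < (1 - k / 2)\<^sup>2"
        using c d0(2) by (intro power_strict_mono) (auto simp: X_def ck)
      then have "(X d)\<^sup>2 < 1 - k + k\<^sup>2 / 4"
        by (simp add: power2_eq_square algebra_simps)
      then have "(Y d0)\<^sup>2 < 2 * \<bar>(X d)\<^sup>2 - 1\<bar>"
        using kk k Y_d0 abs_ge_minus_self[of "(X d)\<^sup>2 - 1"] by argo
      then show ?thesis ..
    next
      case False
      then have "2 * d0 * s < d * s" using that s by (intro mult_strict_right_mono) (auto simp: J_def)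
      then have "(1 + k)\<^sup>2 < (X d)\<^sup>2"
        using that d0(2) k by (intro power_strict_mono) (auto simp: X_def ck)
      then have "1 + 2 * k + k\<^sup>2 < (X d)\<^sup>2"
        by (simp add: power2_eq_square algebra_simps)
      then have "(Y d0)\<^sup>2 < 2 * \<bar>(X d)\<^sup>2 - 1\<bar>"
        using kk k Y_d0 zero_le_power2[of k] abs_ge_self[of "(X d)\<^sup>2 - 1"] by argo
      then show ?thesis ..
    qed
    show "(Y d0)\<^sup>2 \<le> 2" using Y_d0 k by simp
  qed (use k h d0 X_d0 in \<open>auto simp: simp_radial_error_ge X_def Y_def J_def intro!: continuous_intros\<close>)
qed

subsection \<open>Quartic interpolants\<close>

lemma unique_best_4:
  fixes \<phi> :: real
  assumes \<phi>: "0 < \<phi>" "\<phi> \<le> pi / 2" and h: "error_scale h"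
  shows "\<exists>!d. is_arg_min (\<lambda>d. max_abs (\<lambda>t. h (simp_radial_error \<phi> 4 t d)))
    (\<lambda>d. d \<in> admissible \<phi> 4) d"
proof -
  define c s where "c = cos \<phi>" and "s = sin \<phi>"
  define k where "k = 1 - c"
  have c: "0 \<le> c" "c < 1" and s: "0 < s" and k: "0 < k" "k \<le> 1" and ck: "c = 1 - k"
    and s2: "s\<^sup>2 = k * (1 + c)"
    using cos_sin_half_period[OF \<phi>] by (simp_all add: c_def s_def k_def)
  have s2': "s\<^sup>2 = 1 - c\<^sup>2" unfolding s2 ck by algebra

  \<comment> \<open>The equation \<open>X = 1\<close>, quadratic in the tangent length
    \<open>r\<close>, has up to a constant factor the discriminant \<open>k ^ 3 * (3 + c)\<close>,
    whose root is \<open>k\<^sup>2 * R / s\<close>.\<close>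
  define R where "R = sqrt ((2 + c)\<^sup>2 - 1)"
  have "(2 + c)\<^sup>2 \<ge> 2\<^sup>2" using c by (intro power_mono) auto
  then have R2: "R\<^sup>2 = (2 + c)\<^sup>2 - 1" and R_pos: "0 \<le> R" by (simp_all add: R_def)
  have R_less: "R < 2 + c"
    by (rule power2_less_imp_less) (use R2 c in auto)
  have R_ge: "3/2 + c \<le> R"
    by (rule power2_le_imp_le) (use R2 c R_pos in \<open>simp_all add: power2_eq_square algebra_simps\<close>)

  \<comment> \<open>\<open>rp\<close> is the larger root of \<open>X = 1\<close>, regarded as a quadratic equation for \<open>r = \<surd>3/2 \<surd>(1 - c d)\<close>;
    unlike the formula for \<open>d\<close> in terms of \<open>r\<close>, all that follows survives \<open>c = 0\<close>.\<close>
  define rp where "rp = (s * c + k\<^sup>2 * R / s) / 2"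
  have rps: "2 * (rp * s) = s\<^sup>2 * c + k\<^sup>2 * R"
    using s by (simp add: rp_def field_simps power2_eq_square)
  have "s\<^sup>2 * (4 * rp\<^sup>2) = s\<^sup>2 * (4 * (rp * s) * c + (5 * c\<^sup>2 - 8 * c + 3))"
    using rps R2 s2 ck by algebra
  then have rp2: "4 * rp\<^sup>2 = 4 * (rp * s) * c + (5 * c\<^sup>2 - 8 * c + 3)"
    using s by simp
  have "s * s \<le> 2 * (rp * s)"
  proof -
    have "k\<^sup>2 * (1 + c) \<le> k\<^sup>2 * R" using R_ge by (intro mult_left_mono) auto
    moreover have "k\<^sup>2 * (1 + c) + s\<^sup>2 * c = s\<^sup>2" using s2 ck by algebra
    ultimately show ?thesis using rps by (simp add: power2_eq_square)
  qed
  then have "s * s \<le> (2 * rp) * s" by simp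
  then have rp_ge: "s / 2 \<le> rp" using s by simp

  define d0 where "d0 = (8 - 5 * c - 4 * (rp * s)) / 3"
  have d0_eq: "3 * d0 = 8 - 5 * c - 4 * (rp * s)" by (simp add: d0_def)
  have cd0: "3 * (c * d0) = 3 - 4 * rp\<^sup>2"
    using rp2 d0_eq by algebra
  \<comment> \<open>This is the value of \<open>K\<close> at \<open>d0\<close>, in a form where
    \<open>0 < K0 \<le> k\<^sup>2 / 4\<close> follows from
    \<open>3/2 + c \<le> R < 2 + c\<close>.\<close>
  define K0 where "K0 = k\<^sup>2 * (2 + c - R) / 2"
  have K0_eq: "K0 = 1 - c - rp * s"
  proof -
    have "2 * (1 - c - rp * s) = 2 * K0"
    proof -
      have "2 * K0 = k\<^sup>2 * (2 + c - R)" by (simp add: K0_def)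
      then show ?thesis using rps s2 ck by algebra
    qed
    then show ?thesis by simp
  qed
  have K0_pos: "0 < K0" using R_less k by (simp add: K0_def)
  have K0_le: "K0 \<le> k\<^sup>2 / 4"
  proof -
    have "k\<^sup>2 * (2 + c - R) \<le> k\<^sup>2 * (1/2)" using R_ge by (intro mult_left_mono) auto
    then show ?thesis by (simp add: K0_def)
  qed
  have kk: "k\<^sup>2 \<le> 1" using k by (simp add: power_le_one)

  define r where "r d = sqrt 3 / 2 * sqrt (1 - c * d)" for d
  define X K where "X d = (5 * c + 4 * r d * s + 3 * d) / 8"
    and "K d = (3 * d - 3 * c - 4 * r d * s) / 8" for d
  have X8: "8 * X d = 5 * c + 4 * (r d * s) + 3 * d"
    and K8: "8 * K d = 3 * d - 3 * c - 4 * (r d * s)" for d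
    by (simp_all add: X_def K_def)
  have r_pos: "0 \<le> r d" if "c * d \<le> 1" for d
    using that by (simp add: r_def)
  have r2: "4 * (r d)\<^sup>2 = 3 - 3 * (c * d)" if "c * d \<le> 1" for d
    using that by (simp add: r_def power_mult_distrib power_divide)
  have r_mono: "r d' \<le> r d" if "d \<le> d'" "c * d' \<le> 1" for d d'
    using that c by (auto simp: r_def mult_left_mono)
  have cd0_le: "c * d0 \<le> 1"
    using cd0 zero_le_power2[of rp] by linarith
  have r_d0: "r d0 = rp"
  proof (rule power2_eq_imp_eq)
    show "(r d0)\<^sup>2 = rp\<^sup>2" using r2[OF cd0_le] cd0 by simp
  qed (use r_pos[OF cd0_le] rp_ge s in auto)
  have X_d0: "X d0 = 1" using d0_eq by (simp add: X_def r_d0)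
  have K_d0: "K d0 = K0" using d0_eq by (simp add: K_def r_d0 K0_eq)

  \<comment> \<open>The half-line condition means \<open>r d \<ge> s / 2\<close> and keeps away from
    \<open>c * d = 1\<close>, where \<open>r\<close> vanishes. Since \<open>r\<close> decreases,
    \<open>K\<close> grows at rate at least 3/8, so a distance \<open>8 * K0\<close> from
    \<open>d0\<close> changes \<open>K\<close> by \<open>3 * K0\<close>, to at most
    \<open>- 2 * K0\<close> or at least \<open>4 * K0\<close>.\<close>
  define J where "J = {d0 - 8 * K0..d0 + 8 * K0} \<inter> {d. 3 * (c * d) \<le> 3 - s\<^sup>2}"
  have adm: "admissible \<phi> 4 = {d. c * d < 1}" by (simp add: admissible_def c_def)
  have J_adm: "c * d < 1" if "d \<in> J" for d
  proof -
    have "0 < s\<^sup>2" using s by simp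
    moreover have "3 * (c * d) \<le> 3 - s\<^sup>2" using that by (simp add: J_def)
    ultimately show ?thesis by linarith
  qed
  have r_ge: "s / 2 \<le> r d" if "d \<in> J" for d
  proof (rule power2_le_imp_le)
    show "(s / 2)\<^sup>2 \<le> (r d)\<^sup>2"
      using that r2[of d] J_adm[OF that] by (simp add: J_def power_divide)
  qed (use r_pos[of d] J_adm[OF that] in simp)
  have d0_J: "d0 \<in> J"
  proof -
    have "(s / 2)\<^sup>2 \<le> rp\<^sup>2" using rp_ge s by (intro power_mono) auto
    then show ?thesis using K0_pos cd0 by (simp add: J_def power_divide)
  qed
  have r_diff: "4 * (r d - r d') * (r d + r d') = 3 * c * (d' - d)" if "d \<in> J" "d' \<in> J" for d d'
    using r2[of d] r2[of d'] J_adm[OF that(1)] J_adm[OF that(2)]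
    by (simp add: power2_eq_square algebra_simps)
  \<comment> \<open>On \<open>J\<close> the sum \<open>r d + r d'\<close> is at least
    \<open>s\<close>, which bounds the slope of \<open>r\<close>.\<close>
  have r_diff_le: "4 * s * (r d - r d') \<le> 3 * c * (d' - d)" if d: "d \<in> J" "d' \<in> J" "d \<le> d'" for d d'
  proof -
    have "4 * (r d - r d') * s \<le> 4 * (r d - r d') * (r d + r d')"
      using r_ge[OF d(1)] r_ge[OF d(2)] r_mono[OF d(3)] J_adm[OF d(2)]
      by (intro mult_left_mono) auto
    then show ?thesis unfolding r_diff[OF d(1,2)] by (simp add: mult.commute mult.left_commute)
  qed
  have X_mono: "X d < X d'" if d: "d \<in> J" "d' \<in> J" "d < d'" for d d'
  proof -
    have "4 * s * (r d - r d') \<le> 3 * c * (d' - d)" using d by (intro r_diff_le) auto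
    also have "\<dots> < 3 * 1 * (d' - d)" using c d(3) by (intro mult_strict_right_mono) auto
    finally show ?thesis by (simp add: X_def algebra_simps)
  qed
  have X_pos: "0 < X d" if d: "d \<in> J" for d
  proof (cases "d0 \<le> d")
    case True
    then show ?thesis using X_mono[OF d0_J d] X_d0 by (cases "d = d0") auto
  next
    case False
    then have "rp * s \<le> r d * s"
      using r_mono[of d d0] cd0_le s unfolding r_d0 by (intro mult_right_mono) auto
    then have "X d0 - X d \<le> 3 / 8 * (d0 - d)" using X8[of d] X8[of d0] unfolding r_d0 by argo
    also have "\<dots> \<le> 3 * K0" using d by (simp add: J_def)
    also have "\<dots> \<le> 3 / 4" using K0_le kk by simp
    finally show ?thesis by (simp add: X_d0)
  qed

  show ?thesis
  proof (rule unique_best_parameter[where h = h and \<psi> = "simp_radial_error \<phi> 4" and X = X and Y = K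
        and m = 3 and \<sigma> = "-1" and J = J and ?d0.0 = d0])
    show "simp_radial_error \<phi> 4 t d = (1 - t\<^sup>2) ^ 3 * ((X d)\<^sup>2 - 1 + (-1) * (K d)\<^sup>2 * t\<^sup>2)"
      if "d \<in> admissible \<phi> 4" for t d
      using simp_radial_error_4[of \<phi> d t] that unfolding adm
      by (simp add: X_def K_def r_def c_def s_def)
    show "J \<subseteq> admissible \<phi> 4" using J_adm unfolding adm by blast
    show "compact J" unfolding J_def
      by (intro compact_Int_closed compact_Icc closed_Collect_le continuous_intros)
    show "convex J"
    proof -
      have "{d. 3 * (c * d) \<le> 3 - s\<^sup>2} = {d. inner (3 * c) d \<le> 3 - s\<^sup>2}"
        by (simp add: mult.assoc)
      then show ?thesis unfolding J_def
        by (metis convex_Int convex_real_interval(5) convex_halfspace_le)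
    qed
    show "(X d)\<^sup>2 < (X d')\<^sup>2" if "d \<in> J" "d' \<in> J" "d < d'" for d d'
      using X_mono[OF that] X_pos[OF that(1)] by (intro power_strict_mono) auto
    show "(X d)\<^sup>2 + (-1) * (K d)\<^sup>2 \<le> (X d')\<^sup>2 + (-1) * (K d')\<^sup>2"
      if d: "d \<in> J" "d' \<in> J" "d < d'" for d d'
    proof -
      \<comment> \<open>Factored as the difference of squares, with
        \<open>X d - K d = c + r d * s\<close> and
        \<open>4 * (X d + K d) = c + 3 * d\<close>.\<close>
      have eq: "4 * ((X d)\<^sup>2 + (-1) * (K d)\<^sup>2) = (c + r d * s) * (c + 3 * d)" for d
        by (simp add: X_def K_def power2_eq_square field_simps)
      have r: "s / 2 \<le> r d'" "r d' \<le> r d"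
        using r_ge[OF d(2)] r_mono[of d d'] d(3) J_adm[OF d(2)] by auto
      define q where "q = 4 * (r d + r d')"
      have q: "0 < q" using r s by (simp add: q_def)
      \<comment> \<open>After multiplication by \<open>q\<close>, the difference of the two products
        is \<open>3 * (d' - d)\<close> times this expression. Inserting the bound
        \<open>s / 2\<close> for both values of \<open>r\<close> leaves the nonnegative remainder
        \<open>4 * s * c * k\<close>.\<close>
      have *: "0 \<le> q * (c + r d' * s) - s * (c\<^sup>2 + 3 - 4 * (r d)\<^sup>2)"
      proof -
        have "4 * s * (c + s / 2 * s) \<le> q * (c + r d' * s)"
          using r s c by (intro mult_mono add_mono mult_right_mono) (auto simp: q_def)
        moreover have "s * (4 * (s / 2)\<^sup>2) \<le> s * (4 * (r d)\<^sup>2)"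
          using r s by (intro mult_left_mono power_mono) auto
        moreover have "4 * s * (c + s / 2 * s) + s * (4 * (s / 2)\<^sup>2) = s * (4 * c + 3 * s\<^sup>2)"
          by (simp add: power2_eq_square field_simps)
        moreover have "s * (4 * c + 3 * s\<^sup>2) = s * (c\<^sup>2 + 3) + 4 * s * c * k"
          using s2' ck by algebra
        moreover have "0 \<le> 4 * s * c * k" using s c k by simp
        ultimately show ?thesis by (simp add: algebra_simps)
      qed
      have r2d: "4 * (r d)\<^sup>2 = 3 - 3 * (c * d)" using J_adm[OF d(1)] by (intro r2) simp
      have "q * ((c + r d' * s) * (c + 3 * d') - (c + r d * s) * (c + 3 * d))
          = 3 * (d' - d) * (q * (c + r d' * s) - s * (c\<^sup>2 + 3 - 4 * (r d)\<^sup>2))"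
        using r_diff[OF d(1,2)] r2d unfolding q_def by algebra
      also have "\<dots> \<ge> 0" using * d(3) by (intro mult_nonneg_nonneg) auto
      finally have "0 \<le> (c + r d' * s) * (c + 3 * d') - (c + r d * s) * (c + 3 * d)"
        using q by (simp add: zero_le_mult_iff)
      then have "4 * ((X d)\<^sup>2 + (-1) * (K d)\<^sup>2) \<le> 4 * ((X d')\<^sup>2 + (-1) * (K d')\<^sup>2)"
        unfolding eq by simp
      then show ?thesis by simp
    qed
    show "(K d0)\<^sup>2 < 2 * \<bar>(X d)\<^sup>2 - 1\<bar> \<or> 2 * (K d0)\<^sup>2 < (K d)\<^sup>2"
      if d: "d \<in> admissible \<phi> 4" "d \<notin> J" for d
    proof -
      have cd: "c * d \<le> 1" using d(1) adm by auto
      have "2 * K0 \<le> \<bar>K d\<bar>"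
      proof -
        consider "3 - s\<^sup>2 < 3 * (c * d)" | "d < d0 - 8 * K0" | "d0 + 8 * K0 < d"
          using d(2) by (force simp: J_def)
        then show ?thesis
        proof cases
          case 1
          have "s\<^sup>2 \<le> 1" using s2' by simp
          with 1 have "0 < c * d" by linarith
          then have c_pos: "0 < c" using c by (cases "c = 0") auto
          have "(r d)\<^sup>2 \<le> (s / 2)\<^sup>2" using 1 r2[OF cd] by (simp add: power_divide)
          then have r: "r d \<le> s / 2" by (rule power2_le_imp_le) (use s in simp)
          \<comment> \<open>Multiplying \<open>K d\<close> by \<open>c\<close> allows
            \<open>d\<close> to be eliminated in favour of \<open>r d\<close>; then
            \<open>r d \<le> s / 2\<close> gives
            \<open>K d \<ge> k\<^sup>2 / 2 \<ge> 2 * K0\<close>.\<close>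
          have "r d * (s * c) \<le> s / 2 * (s * c)" using r s c by (intro mult_right_mono) auto
          moreover have "8 * (c * K d) = 3 * s\<^sup>2 - 4 * (r d)\<^sup>2 - 4 * (r d * (s * c))"
            unfolding r2[OF cd] s2' by (simp add: K_def power2_eq_square field_simps)
          ultimately have "2 * s\<^sup>2 - 2 * (s * s * c) \<le> 8 * (c * K d)"
            using \<open>(r d)\<^sup>2 \<le> (s / 2)\<^sup>2\<close> by (simp add: power_divide)
          moreover have "2 * s\<^sup>2 - 2 * (s * s * c) = 2 * k\<^sup>2 * (1 + c)"
            using s2 ck by algebra
          moreover have "2 * k\<^sup>2 * (c + c) \<le> 2 * k\<^sup>2 * (1 + c)"
            using c by (intro mult_left_mono) auto
          ultimately have "c * (k\<^sup>2 / 2) \<le> c * K d" by (simp add: algebra_simps)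
          then have "k\<^sup>2 / 2 \<le> K d" using c_pos by simp
          then show ?thesis using K0_le by linarith
        next
          case 2
          have "rp * s \<le> r d * s"
            using r_mono[of d d0] cd0_le s 2 K0_pos unfolding r_d0 by (intro mult_right_mono) auto
          then have "K d - K d0 \<le> 3 / 8 * (d - d0)" using K8[of d] K8[of d0] unfolding r_d0 by argo
          then show ?thesis using 2 by (simp add: K_d0)
        next
          case 3
          have "r d * s \<le> rp * s"
            using r_mono[of d0 d] cd s 3 K0_pos unfolding r_d0 by (intro mult_right_mono) auto
          then have "3 / 8 * (d - d0) \<le> K d - K d0" using K8[of d] K8[of d0] unfolding r_d0 by argo
          then show ?thesis using 3 by (simp add: K_d0)
        qed
      qed
      then have "(2 * K0)\<^sup>2 \<le> \<bar>K d\<bar>\<^sup>2" using K0_pos by (intro power_mono) auto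
      then have "4 * K0\<^sup>2 \<le> (K d)\<^sup>2" by (simp add: power_mult_distrib)
      moreover have "0 < K0\<^sup>2" using K0_pos by simp
      ultimately have "2 * K0\<^sup>2 < (K d)\<^sup>2" by linarith
      then show ?thesis by (simp add: K_d0)
    qed
    show "(K d0)\<^sup>2 \<le> 2"
    proof -
      have "K0 \<le> 1" using K0_le kk by linarith
      then have "K0\<^sup>2 \<le> 1" using K0_pos by (simp add: power_le_one)
      then show ?thesis by (simp add: K_d0)
    qed
    show "continuous_on J X" "continuous_on J K"
      unfolding X_def K_def r_def by (intro continuous_intros; simp)+
  qed (use h d0_J X_d0 in \<open>auto simp: simp_radial_error_ge\<close>)
qed

subsection \<open>Quintic interpolants\<close>

text \<open>
  Let \<open>k = 1 - c\<close> and \<open>5 d = 2 s (1 + k \<rho>)\<close>. In the parameter \<open>\<rho>\<close> the quintic has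
  \<open>X = 1 + k\<^sup>4/8 quintic_x\<close> and \<open>Y = s k\<^sup>2/8 quintic_y\<close>, and all relevant quantities stay bounded
  away from degeneracy as \<open>k \<rightarrow> 0\<close>.
\<close>

definition quintic_x :: "real \<Rightarrow> real \<Rightarrow> real" where
  "quintic_x k \<rho> = - (\<rho> * (2 - 3 * (2 - k) * \<rho> + (2 - k) * (1 - k) * \<rho>\<^sup>2)) / (2 - k + k * \<rho>)"

definition quintic_y :: "real \<Rightarrow> real \<Rightarrow> real" where
  "quintic_y k \<rho> =
     (2 - 4 * (1 - k) * \<rho> - (2 + 4 * k - 3 * k\<^sup>2) * \<rho>\<^sup>2 - k\<^sup>2 * (2 - k) * \<rho> ^ 3) / (2 - k + k * \<rho>)"

text \<open>The factor \<open>s\<close> of \<open>d\<close> also splits off the denominator,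
  \<open>W = 2 * s * w\<close>, and the substitution makes the powers of \<open>k\<close> in
  \<open>X - 1\<close> and \<open>Y\<close> explicit.\<close>

lemma simp_radial_error_5_scaled:
  fixes \<phi> \<rho> t :: real
  assumes \<phi>: "0 < \<phi>" "\<phi> \<le> pi / 2"
  defines "k \<equiv> 1 - cos \<phi>" and "s \<equiv> sin \<phi>"
  defines "d \<equiv> 2 * s * (1 + k * \<rho>) / 5"
  assumes d: "0 < d"
  shows "simp_radial_error \<phi> 5 t d =
    (1 - t\<^sup>2) ^ 4 * ((1 + k ^ 4 / 8 * quintic_x k \<rho>)\<^sup>2 - 1 + 1 * (s * k\<^sup>2 / 8 * quintic_y k \<rho>)\<^sup>2 * t\<^sup>2)"
proof -
  define c where "c = 1 - k"
  have c: "0 \<le> c" "cos \<phi> = c" and s: "0 < s" and s2: "s\<^sup>2 = k * (2 - k)"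
    using cos_sin_half_period[OF \<phi>] by (simp_all add: c_def k_def s_def)
  define w where "w = 2 - k + k * \<rho>"
  define W where "W = 5 * d + 2 * s * c"
  have W: "W = 2 * s * w" by (simp add: W_def d_def w_def c_def algebra_simps)
  have W_pos: "0 < W" using d s c by (simp add: W_def add_pos_nonneg)
  then have w: "0 < w" using s by (simp add: W zero_less_mult_iff)
  define D where "D = 2 * s * (1 + k * \<rho>)"
  have D: "5 * d = D" by (simp add: D_def d_def)
  define B where "B = (5 * d * (4 - 5 * d\<^sup>2) * c + 4 * (2 + 5 * d\<^sup>2) * s) / (4 * W)"
  define C where "C = 5 * d * ((4 - 5 * d\<^sup>2) * s - 6 * d * c) / (4 * W)"
  have "4 * W * B = 5 * d * (4 - 5 * d\<^sup>2) * c + 4 * (2 + 5 * d\<^sup>2) * s"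
    "4 * W * C = 5 * d * ((4 - 5 * d\<^sup>2) * s - 6 * d * c)"
    using W_pos by (simp_all add: B_def C_def)
  then have B: "20 * W * B = D * (20 - D\<^sup>2) * c + (40 + 4 * D\<^sup>2) * s"
    and C: "20 * W * C = D * (20 - D\<^sup>2) * s - 6 * D\<^sup>2 * c"
    using D by algebra+
  define x where "x = (6 * c + 5 * d * s + 10 * B) / 16"
  define y where "y = (5 * d * c - 4 * s + 10 * C) / 16"
  have x: "16 * x = 6 * c + D * s + 10 * B" and y: "16 * y = D * c - 4 * s + 10 * C"
    by (simp_all add: x_def y_def D)
  \<comment> \<open>As \<open>64 * s * w = 32 * W\<close>, all denominators disappear; what remains
    is a polynomial identity modulo \<open>s\<^sup>2 = k * (2 - k)\<close>.\<close>
  have "s * (64 * w * (x - 1)) = 2 * W * (6 * c + D * s - 16) + 20 * W * B"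
    using x W by algebra
  also have "\<dots> = s * (- 8 * (k ^ 4) * (\<rho> * (2 - 3 * (2 - k) * \<rho> + (2 - k) * (1 - k) * \<rho>\<^sup>2)))"
    unfolding B using s2 c_def unfolding W w_def D_def by algebra
  finally have "64 * w * (x - 1)
      = - 8 * (k ^ 4) * (\<rho> * (2 - 3 * (2 - k) * \<rho> + (2 - k) * (1 - k) * \<rho>\<^sup>2))"
    by (rule mult_left_cancel[THEN iffD1, rotated]) (use s in simp)
  then have x_eq: "x = 1 + k ^ 4 / 8 * quintic_x k \<rho>"
    using w unfolding quintic_x_def w_def[symmetric] by (simp add: field_simps)
  have "s * (64 * w * y) = 2 * W * (D * c - 4 * s) + 20 * W * C"
    using y W by algebra
  also have "\<dots> = s * (8 * s * k\<^sup>2 *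
      (2 - 4 * (1 - k) * \<rho> - (2 + 4 * k - 3 * k\<^sup>2) * \<rho>\<^sup>2 - k\<^sup>2 * (2 - k) * \<rho> ^ 3))"
    unfolding C using s2 c_def unfolding W w_def D_def by algebra
  finally have "64 * w * y = 8 * s * k\<^sup>2 *
      (2 - 4 * (1 - k) * \<rho> - (2 + 4 * k - 3 * k\<^sup>2) * \<rho>\<^sup>2 - k\<^sup>2 * (2 - k) * \<rho> ^ 3)"
    by (rule mult_left_cancel[THEN iffD1, rotated]) (use s in simp)
  then have y_eq: "y = s * k\<^sup>2 / 8 * quintic_y k \<rho>"
    using w unfolding quintic_y_def w_def[symmetric] by (simp add: field_simps)
  show ?thesis
    using simp_radial_error_5[of d \<phi> t] W_pos
    unfolding x_eq[symmetric] y_eq[symmetric]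
    by (simp add: c(2) s_def[symmetric] W_def x_def y_def B_def C_def)
qed

section \<open>Derivatives and monotonicity of the quintic coefficients\<close>

lemma quintic_x_deriv:
  assumes "2 - k + k * \<rho> \<noteq> 0"
  shows "(quintic_x k has_real_derivative
    (- 2 * (2 - k) + 6 * (2 - k)\<^sup>2 * \<rho> - 3 * (2 - k)\<^sup>2 * (1 - k) * \<rho>\<^sup>2
      + 3 * k * (2 - k) * \<rho>\<^sup>2 - 2 * k * (2 - k) * (1 - k) * \<rho> ^ 3) / (2 - k + k * \<rho>)\<^sup>2) (at \<rho>)"
  unfolding quintic_x_def[abs_def]
  by (rule derivative_eq_intros refl assms)+
    (simp add: power2_eq_square power3_eq_cube algebra_simps)

lemma quintic_y_deriv:
  assumes "2 - k + k * \<rho> \<noteq> 0"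
  shows "(quintic_y k has_real_derivative
    - ((4 * (1 - k) + 2 * (2 + 4 * k - 3 * k\<^sup>2) * \<rho> + 3 * k\<^sup>2 * (2 - k) * \<rho>\<^sup>2) * (2 - k + k * \<rho>)
      + k * (2 - 4 * (1 - k) * \<rho> - (2 + 4 * k - 3 * k\<^sup>2) * \<rho>\<^sup>2 - k\<^sup>2 * (2 - k) * \<rho> ^ 3))
      / (2 - k + k * \<rho>)\<^sup>2) (at \<rho>)"
  unfolding quintic_y_def[abs_def]
  by (rule derivative_eq_intros refl assms)+
    (simp add: power2_eq_square power3_eq_cube algebra_simps)

text \<open>\<open>x'\<close> is the numerator of the derivative of \<open>quintic_x\<close>,
  \<open>l\<close> the numerator of \<open>quintic_y\<close>, and \<open>l'\<close> minus the
  derivative of \<open>l\<close>. The fourth bound is what lets the growth of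
  \<open>X\<^sup>2\<close> outweigh a possible decrease of \<open>Y\<^sup>2\<close>.\<close>

lemma quintic_deriv_bounds:
  fixes k \<rho> :: real
  assumes k: "0 < k" "k \<le> 1" and \<rho>: "1/2 \<le> (2 - k) * \<rho>" "(2 - k) * \<rho> \<le> 6/5"
  defines "w \<equiv> 2 - k + k * \<rho>"
    and "x' \<equiv> - 2 * (2 - k) + 6 * (2 - k)\<^sup>2 * \<rho> - 3 * (2 - k)\<^sup>2 * (1 - k) * \<rho>\<^sup>2
      + 3 * k * (2 - k) * \<rho>\<^sup>2 - 2 * k * (2 - k) * (1 - k) * \<rho> ^ 3"
    and "l \<equiv> 2 - 4 * (1 - k) * \<rho> - (2 + 4 * k - 3 * k\<^sup>2) * \<rho>\<^sup>2 - k\<^sup>2 * (2 - k) * \<rho> ^ 3"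
    and "l' \<equiv> 4 * (1 - k) + 2 * (2 + 4 * k - 3 * k\<^sup>2) * \<rho> + 3 * k\<^sup>2 * (2 - k) * \<rho>\<^sup>2"
  shows "5/4 \<le> w" "l \<le> 9/8" "0 \<le> l'" "k * (2 - k) * (l' + k) < 6 * x'"
    "- (6/5) \<le> quintic_x k \<rho>" "0 \<le> l' * w + k * l"
proof -
  define p c b where "p = 2 - k" and "c = 1 - k" and "b = 2 + 4 * k - 3 * k\<^sup>2"
  define x where "x = p * \<rho>"
  define y where "y = x - 1/2"
  have p: "1 \<le> p" "p \<le> 2" and c: "0 \<le> c" and x: "1/2 \<le> x" "x \<le> 6/5" and y: "0 \<le> y" "y \<le> 7/10"
    using k \<rho> unfolding p_def c_def x_def y_def by linarith+
  have b: "0 \<le> b"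
  proof -
    have "k * k \<le> 1 * k" using k by (intro mult_right_mono) auto
    then show ?thesis using k unfolding b_def power2_eq_square by linarith
  qed
  have "0 < p * \<rho>" using x by (simp add: x_def)
  then have \<rho>_pos: "0 < \<rho>" using p by (simp add: zero_less_mult_iff)
  have "p * \<rho> \<le> 2 * \<rho>" using p \<rho>_pos by (intro mult_right_mono) auto
  then have \<rho>_ge: "1/4 \<le> \<rho>" using x by (simp add: x_def)
  have "1 * \<rho> \<le> p * \<rho>" using p \<rho>_pos by (intro mult_right_mono) auto
  then have \<rho>_le: "\<rho> \<le> 6/5" using x by (simp add: x_def)
  have "(2 * c) * \<rho> \<le> p * \<rho>" using k \<rho>_pos by (intro mult_right_mono) (auto simp: c_def p_def)
  then have c\<rho>: "2 * c * \<rho> \<le> x" by (simp add: x_def)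

  have "k * (1/4) \<le> k * \<rho>" using \<rho>_ge k by (intro mult_left_mono) auto
  then show w: "5/4 \<le> w" using k unfolding w_def by argo

  show l'_nonneg: "0 \<le> l'"
    unfolding l'_def b_def[symmetric] using b c p k \<rho>_pos
    by (intro add_nonneg_nonneg mult_nonneg_nonneg) (auto simp: c_def p_def)

  show "0 \<le> l' * w + k * l"
  proof -
    have "l + \<rho> * l' = 2 + b * \<rho>\<^sup>2 + 2 * (k\<^sup>2 * p * \<rho> ^ 3)"
      unfolding l_def l'_def b_def p_def by algebra
    also have "\<dots> \<ge> 0" using b k p \<rho>_pos by simp
    finally have "0 \<le> k * (l + \<rho> * l') + p * l'" using k p l'_nonneg by simp
    also have "\<dots> = l' * w + k * l" by (simp add: w_def p_def algebra_simps)
    finally show ?thesis .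
  qed

  show "l \<le> 9/8"
  proof -
    \<comment> \<open>\<open>p\<^sup>2 * l\<close> decreases in \<open>x\<close>, so each term is
      estimated at the left end \<open>x = 1/2\<close>.\<close>
    have "p * c * (1/2) \<le> p * c * x" using p c x by (intro mult_left_mono) auto
    moreover have "b * (1/2)\<^sup>2 \<le> b * x\<^sup>2" using b x by (intro mult_left_mono power_mono) auto
    moreover have "k\<^sup>2 * (1/2) ^ 3 \<le> k\<^sup>2 * x ^ 3" using k x by (intro mult_left_mono power_mono) auto
    moreover have "p\<^sup>2 * l = 2 * p\<^sup>2 - 4 * (p * c * x) - b * x\<^sup>2 - k\<^sup>2 * x ^ 3"
      unfolding l_def x_def b_def c_def p_def by algebra
    ultimately have "p\<^sup>2 * l \<le> 2 * p\<^sup>2 - 2 * (p * c) - b / 4 - k\<^sup>2 / 8"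
      by (simp add: power_divide)
    also have "\<dots> = 5/8 * p\<^sup>2 + 1/2 * p"
      by (simp add: b_def c_def p_def power2_eq_square field_simps)
    also have "\<dots> \<le> p\<^sup>2 * (9/8)" using p by (simp add: power2_eq_square)
    finally show ?thesis using p by simp
  qed

  show "k * (2 - k) * (l' + k) < 6 * x'"
  proof -
    \<comment> \<open>Using \<open>y\<^sup>2 \<le> 7/10 * y\<close>, both sides are bounded by
      linear functions of \<open>y \<ge> 0\<close>, whose slopes and intercepts are then compared
      separately.\<close>
    have yy: "y\<^sup>2 \<le> 7/10 * y" unfolding power2_eq_square using y by (intro mult_right_mono) auto
    have x2: "x\<^sup>2 = 1/4 + y + y\<^sup>2" by (simp add: y_def power2_eq_square field_simps)
    have "0 \<le> k * p * \<rho>\<^sup>2 * (3 - 2 * c * \<rho>)"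
      using k p c\<rho> x by (intro mult_nonneg_nonneg) auto
    moreover have "x' = p * (6 * x - 2) - 3 * c * x\<^sup>2 + k * p * \<rho>\<^sup>2 * (3 - 2 * c * \<rho>)"
      unfolding x'_def x_def p_def c_def by algebra
    ultimately have "p * (6 * x - 2) - 3 * c * x\<^sup>2 \<le> x'" by simp
    moreover have "c * y\<^sup>2 \<le> c * (7/10 * y)" using c yy by (intro mult_left_mono) auto
    moreover have "p * (6 * x - 2) - 3 * c * x\<^sup>2 = p - 3/4 * c + y * (6 * p - 3 * c) - 3 * (c * y\<^sup>2)"
      unfolding x2 by (simp add: y_def algebra_simps)
    ultimately have lower: "p - 3/4 * c + y * (6 * p - 51/10 * c) \<le> x'"
      by (simp add: algebra_simps)

    have "k * (3 * k\<^sup>2 * y\<^sup>2) \<le> k * (3 * k\<^sup>2 * (7/10 * y))"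
      using k yy by (intro mult_left_mono) auto
    moreover have "k * p * (l' + k) = k * (4 * p * c + b + 3/4 * k\<^sup>2 + k * p)
        + y * (k * (2 * b + 3 * k\<^sup>2)) + k * (3 * k\<^sup>2 * y\<^sup>2)"
    proof -
      have "k * p * (l' + k) = k * (4 * p * c + 2 * b * x + 3 * k\<^sup>2 * x\<^sup>2 + k * p)"
        unfolding l'_def x_def b_def c_def p_def by algebra
      then show ?thesis unfolding x2 by (simp add: y_def algebra_simps)
    qed
    ultimately have upper: "k * p * (l' + k)
        \<le> k * (4 * p * c + b + 3/4 * k\<^sup>2 + k * p) + y * (k * (2 * b + 51/10 * k\<^sup>2))"
      by (simp add: algebra_simps)

    have k2: "k\<^sup>2 \<le> 1" "k * k\<^sup>2 \<le> 1 * k\<^sup>2" using k by (auto simp: power_le_one intro: mult_right_mono)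
    have "k * (2 * b + 51/10 * k\<^sup>2) = 4 * k + 8 * k\<^sup>2 - 9/10 * (k * k\<^sup>2)"
      by (simp add: b_def power2_eq_square algebra_simps)
    also have "\<dots> \<le> 12"
    proof -
      have "0 \<le> k * k\<^sup>2" using k by simp
      then show ?thesis using k k2(1) by argo
    qed
    also have "\<dots> \<le> 6 * (6 * p - 51/10 * c)" using k unfolding p_def c_def by argo
    finally have slope: "y * (k * (2 * b + 51/10 * k\<^sup>2)) \<le> y * (6 * (6 * p - 51/10 * c))"
      using y by (intro mult_left_mono)

    \<comment> \<open>Bounding \<open>k ^ 3\<close> by \<open>k\<^sup>2\<close> leaves the quadratic
      \<open>15/2 - 23/2 * k + 21/4 * k\<^sup>2\<close>, whose vertex is close to 11/10.\<close>
    have "0 \<le> 21/4 * (k - 11/10)\<^sup>2" by simp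
    then have "11/2 * k + 6 * k - 21/4 * k\<^sup>2 < 15/2"
      using k by (simp add: power2_eq_square algebra_simps)
    moreover have "6 * (p - 3/4 * c) - k * (4 * p * c + b + 3/4 * k\<^sup>2 + k * p)
        = 15/2 - 23/2 * k + 6 * k\<^sup>2 - 3/4 * (k * k\<^sup>2)"
      by (simp add: b_def c_def p_def power2_eq_square field_simps)
    ultimately have "k * (4 * p * c + b + 3/4 * k\<^sup>2 + k * p) < 6 * (p - 3/4 * c)"
      using k2 by argo
    with slope upper lower show ?thesis
      unfolding p_def[symmetric] by (simp add: algebra_simps)
  qed

  show "- (6/5) \<le> quintic_x k \<rho>"
  proof -
    define q where "q = 2 - 3 * p * \<rho> + p * c * \<rho>\<^sup>2"
    have "2 * (p * c * \<rho>\<^sup>2) = x * (2 * c * \<rho>)" by (simp add: x_def power2_eq_square)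
    also have "\<dots> \<le> 6/5 * (6/5)"
      by (rule mult_mono) (use x c\<rho> c \<rho>_pos in \<open>linarith | simp\<close>)+
    finally have "2 * (p * c * \<rho>\<^sup>2) \<le> 36/25" by simp
    moreover have "q = 2 - 3 * x + p * c * \<rho>\<^sup>2" by (simp add: q_def x_def)
    ultimately have "q \<le> 61/50" using x by linarith
    then have "\<rho> * q \<le> \<rho> * (61/50)" using \<rho>_pos by (intro mult_left_mono) auto
    also have "\<dots> \<le> 6/5 * w" using \<rho>_le w by simp
    finally have "\<rho> * q / w \<le> 6/5" using w by (simp add: divide_le_eq)
    then show ?thesis
      unfolding quintic_x_def w_def[symmetric] by (simp add: q_def p_def c_def)
  qed
qed

lemma quintic_mono:
  fixes k s \<rho>\<^sub>1 \<rho>\<^sub>2 :: real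
  assumes k: "0 < k" "k \<le> 1" and s: "s\<^sup>2 = k * (2 - k)"
    and \<rho>: "1/2 \<le> (2 - k) * \<rho>\<^sub>1" "\<rho>\<^sub>1 < \<rho>\<^sub>2" "(2 - k) * \<rho>\<^sub>2 \<le> 6/5"
  defines "X \<equiv> \<lambda>\<rho>. 1 + k ^ 4 / 8 * quintic_x k \<rho>" and "Y \<equiv> \<lambda>\<rho>. s * k\<^sup>2 / 8 * quintic_y k \<rho>"
  shows "X \<rho>\<^sub>1 < X \<rho>\<^sub>2" "(X \<rho>\<^sub>1)\<^sup>2 + (Y \<rho>\<^sub>1)\<^sup>2 < (X \<rho>\<^sub>2)\<^sup>2 + (Y \<rho>\<^sub>2)\<^sup>2"
proof -
  have range: "1/2 \<le> (2 - k) * \<rho>" "(2 - k) * \<rho> \<le> 6/5" if "\<rho>\<^sub>1 \<le> \<rho>" "\<rho> \<le> \<rho>\<^sub>2" for \<rho>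
  proof -
    have "(2 - k) * \<rho>\<^sub>1 \<le> (2 - k) * \<rho>" "(2 - k) * \<rho> \<le> (2 - k) * \<rho>\<^sub>2"
      using that k by (auto intro!: mult_left_mono)
    then show "1/2 \<le> (2 - k) * \<rho>" "(2 - k) * \<rho> \<le> 6/5" using \<rho> by linarith+
  qed
  define w where "w \<rho> = 2 - k + k * \<rho>" for \<rho>
  define x' where "x' \<rho> = - 2 * (2 - k) + 6 * (2 - k)\<^sup>2 * \<rho> - 3 * (2 - k)\<^sup>2 * (1 - k) * \<rho>\<^sup>2
      + 3 * k * (2 - k) * \<rho>\<^sup>2 - 2 * k * (2 - k) * (1 - k) * \<rho> ^ 3" for \<rho>
  define l where "l \<rho> = 2 - 4 * (1 - k) * \<rho> - (2 + 4 * k - 3 * k\<^sup>2) * \<rho>\<^sup>2 - k\<^sup>2 * (2 - k) * \<rho> ^ 3" for \<rho>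
  define l' where "l' \<rho> = 4 * (1 - k) + 2 * (2 + 4 * k - 3 * k\<^sup>2) * \<rho> + 3 * k\<^sup>2 * (2 - k) * \<rho>\<^sup>2" for \<rho>
  note bounds = quintic_deriv_bounds[OF k, folded w_def x'_def l_def l'_def]
  have x'_pos: "0 < x' \<rho>" if "\<rho>\<^sub>1 \<le> \<rho>" "\<rho> \<le> \<rho>\<^sub>2" for \<rho>
  proof -
    have "0 \<le> k * (2 - k) * (l' \<rho> + k)"
      using bounds(3)[OF range[OF that]] k by (intro mult_nonneg_nonneg) auto
    then show ?thesis using bounds(4)[OF range[OF that]] by linarith
  qed
  have X_deriv: "(X has_real_derivative k ^ 4 / 8 * (x' \<rho> / (w \<rho>)\<^sup>2)) (at \<rho>)"
    and Y_deriv: "(Y has_real_derivative s * k\<^sup>2 / 8 * (- (l' \<rho> * w \<rho> + k * l \<rho>) / (w \<rho>)\<^sup>2)) (at \<rho>)"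
    if "w \<rho> \<noteq> 0" for \<rho>
    using quintic_x_deriv[of k \<rho>] quintic_y_deriv[of k \<rho>] that
    unfolding X_def Y_def w_def x'_def l_def l'_def by (auto intro!: derivative_eq_intros)
  show "X \<rho>\<^sub>1 < X \<rho>\<^sub>2"
  proof (rule DERIV_pos_imp_increasing[OF \<rho>(2)])
    fix \<rho> assume *: "\<rho>\<^sub>1 \<le> \<rho>" "\<rho> \<le> \<rho>\<^sub>2"
    have "w \<rho> \<noteq> 0" using bounds(1)[OF range[OF *]] by auto
    moreover from this have "0 < k ^ 4 / 8 * (x' \<rho> / (w \<rho>)\<^sup>2)" using x'_pos[OF *] k by simp
    ultimately show "\<exists>y. (X has_real_derivative y) (at \<rho>) \<and> 0 < y"
      using X_deriv[of \<rho>] by blast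
  qed
  show "(X \<rho>\<^sub>1)\<^sup>2 + (Y \<rho>\<^sub>1)\<^sup>2 < (X \<rho>\<^sub>2)\<^sup>2 + (Y \<rho>\<^sub>2)\<^sup>2"
  proof (rule DERIV_pos_imp_increasing[OF \<rho>(2)])
    fix \<rho> assume *: "\<rho>\<^sub>1 \<le> \<rho>" "\<rho> \<le> \<rho>\<^sub>2"
    note b = bounds[OF range[OF *]]
    have w: "0 < w \<rho>" using b(1) by simp
    have Xb: "17/20 \<le> X \<rho>"
    proof -
      have "k ^ 4 / 8 * (- (6/5)) \<le> k ^ 4 / 8 * quintic_x k \<rho>"
        using b(5) k by (intro mult_left_mono) auto
      moreover have "k ^ 4 \<le> 1" using k by (simp add: power_le_one)
      ultimately show ?thesis unfolding X_def by argo
    qed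
    \<comment> \<open>Up to a positive factor this says that the derivative of
      \<open>X\<^sup>2 + Y\<^sup>2\<close> is positive. For \<open>l \<rho> > 0\<close>,
      \<open>l \<rho> \<le> 9/8 \<le> w \<rho>\<close> reduces it to the fourth bound, and the
      constants fit because \<open>9/8 * 6 \<le> 8 * (17/20)\<close>.\<close>
    have "k * (2 - k) * (l \<rho> * (l' \<rho> * w \<rho> + k * l \<rho>)) < 8 * X \<rho> * (x' \<rho> * w \<rho>)"
    proof (cases "l \<rho> \<le> 0")
      case True
      then have "k * (2 - k) * (l \<rho> * (l' \<rho> * w \<rho> + k * l \<rho>)) \<le> 0"
        using b(6) k by (intro mult_nonneg_nonpos mult_nonpos_nonneg) auto
      also have "0 < 8 * X \<rho> * (x' \<rho> * w \<rho>)" using Xb x'_pos[OF *] w by simp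
      finally show ?thesis .
    next
      case False
      have "l \<rho> * (l' \<rho> * w \<rho> + k * l \<rho>) \<le> 9/8 * (l' \<rho> * w \<rho> + k * w \<rho>)"
        using False b w k by (intro mult_mono add_mono mult_left_mono add_nonneg_nonneg mult_nonneg_nonneg) auto
      then have "k * (2 - k) * (l \<rho> * (l' \<rho> * w \<rho> + k * l \<rho>))
          \<le> k * (2 - k) * (9/8 * (l' \<rho> * w \<rho> + k * w \<rho>))"
        using k by (intro mult_left_mono) auto
      also have "\<dots> = 9/8 * (k * (2 - k) * (l' \<rho> + k) * w \<rho>)" by (simp add: field_simps)
      also have "\<dots> < 9/8 * (6 * x' \<rho> * w \<rho>)"
        by (intro mult_strict_left_mono mult_strict_right_mono b(4) w) simp
      also have "\<dots> \<le> 8 * (17/20) * (x' \<rho> * w \<rho>)" using x'_pos[OF *] w by simp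
      also have "\<dots> \<le> 8 * X \<rho> * (x' \<rho> * w \<rho>)"
        using Xb x'_pos[OF *] w by (intro mult_right_mono) auto
      finally show ?thesis .
    qed
    then have "0 < k ^ 4 / (32 * (w \<rho>) ^ 3) *
        (8 * X \<rho> * (x' \<rho> * w \<rho>) - k * (2 - k) * (l \<rho> * (l' \<rho> * w \<rho> + k * l \<rho>)))"
      using k w by simp
    also have "\<dots> = 2 * X \<rho> * (k ^ 4 / 8 * (x' \<rho> / (w \<rho>)\<^sup>2))
        + 2 * Y \<rho> * (s * k\<^sup>2 / 8 * (- (l' \<rho> * w \<rho> + k * l \<rho>) / (w \<rho>)\<^sup>2))"
    proof -
      have Y_eq: "Y \<rho> = s * k\<^sup>2 / 8 * (l \<rho> / w \<rho>)"
        by (simp add: Y_def quintic_y_def l_def w_def)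
      have "2 * Y \<rho> * (s * k\<^sup>2 / 8 * (- (l' \<rho> * w \<rho> + k * l \<rho>) / (w \<rho>)\<^sup>2))
        = - (s\<^sup>2 * k ^ 4 / (32 * (w \<rho>) ^ 3) * (l \<rho> * (l' \<rho> * w \<rho> + k * l \<rho>)))"
        unfolding Y_eq using w
        by (simp add: power2_eq_square power3_eq_cube power4_eq_xxxx field_simps)
      moreover have "2 * X \<rho> * (k ^ 4 / 8 * (x' \<rho> / (w \<rho>)\<^sup>2))
        = k ^ 4 / (32 * (w \<rho>) ^ 3) * (8 * X \<rho> * (x' \<rho> * w \<rho>))"
        using w by (simp add: power2_eq_square power3_eq_cube)
      ultimately show ?thesis unfolding s by (simp add: right_diff_distrib)
    qed
    finally have "0 < 2 * X \<rho> * (k ^ 4 / 8 * (x' \<rho> / (w \<rho>)\<^sup>2))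
        + 2 * Y \<rho> * (s * k\<^sup>2 / 8 * (- (l' \<rho> * w \<rho> + k * l \<rho>) / (w \<rho>)\<^sup>2))" .
    moreover have "((\<lambda>\<rho>. (X \<rho>)\<^sup>2 + (Y \<rho>)\<^sup>2) has_real_derivative
        2 * X \<rho> * (k ^ 4 / 8 * (x' \<rho> / (w \<rho>)\<^sup>2))
        + 2 * Y \<rho> * (s * k\<^sup>2 / 8 * (- (l' \<rho> * w \<rho> + k * l \<rho>) / (w \<rho>)\<^sup>2))) (at \<rho>)"
      using X_deriv[of \<rho>] Y_deriv[of \<rho>] w by (auto intro!: derivative_eq_intros)
    ultimately show "\<exists>y. ((\<lambda>\<rho>. (X \<rho>)\<^sup>2 + (Y \<rho>)\<^sup>2) has_real_derivative y) (at \<rho>) \<and> 0 < y"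
      by blast
  qed
qed
text \<open>
  The cubic equation \<open>X(d) = 1\<close> has the root \<open>\<rho> = 0\<close>; the relevant one is the smaller root of the
  remaining quadratic factor.
\<close>

lemma quintic_root:
  fixes k :: real
  assumes k: "0 < k" "k \<le> 1"
  obtains \<rho> where "2/3 \<le> (2 - k) * \<rho>" "(2 - k) * \<rho> \<le> 77/100" "quintic_x k \<rho> = 0"
    "\<bar>quintic_y k \<rho>\<bar> \<le> 27/100"
proof -
  define p where "p = 2 - k"
  have p: "1 \<le> p" "p \<le> 2" and kp: "k = 2 - p" using k by (simp_all add: p_def)
  \<comment> \<open>This is \<open>p\<close> times the quadratic factor of \<open>quintic_x\<close>,
    written in \<open>x = p * \<rho>\<close>. It is nonnegative at 2/3 and nonpositive at 77/100 for
    all \<open>p\<close> between 1 and 2.\<close>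
  define q where "q x = 2 * p - 3 * p * x + (p - 1) * x\<^sup>2" for x
  have "\<exists>x\<ge>2/3. x \<le> 77/100 \<and> q x = 0"
  proof (rule IVT2)
    show "q (77/100) \<le> 0" "0 \<le> q (2/3)" using p by (simp_all add: q_def power2_eq_square)
    show "\<forall>x. 2/3 \<le> x \<and> x \<le> 77/100 \<longrightarrow> isCont q x"
      unfolding q_def[abs_def] by (intro allI impI continuous_intros)
  qed simp
  then obtain x where x: "2/3 \<le> x" "x \<le> 77/100" "q x = 0" by blast
  define \<rho> where "\<rho> = x / p"
  have p\<rho>: "p * \<rho> = x" using p by (simp add: \<rho>_def)
  have \<rho>: "0 \<le> \<rho>" using x p by (simp add: \<rho>_def)
  define w where "w = p + k * \<rho>"
  define l where "l = 2 - 4 * (1 - k) * \<rho> - (2 + 4 * k - 3 * k\<^sup>2) * \<rho>\<^sup>2 - k\<^sup>2 * p * \<rho> ^ 3"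
  have w: "0 < w" using p k \<rho> by (simp add: w_def add_pos_nonneg)
  have "p * (2 - 3 * p * \<rho> + p * (1 - k) * \<rho>\<^sup>2) = q x"
    unfolding q_def kp p\<rho>[symmetric] by algebra
  then have "quintic_x k \<rho> = 0" using x p by (simp add: quintic_x_def p_def)
  moreover have "\<bar>quintic_y k \<rho>\<bar> \<le> 27/100"
  proof -
    define b where "b = 2 + 4 * k - 3 * k\<^sup>2"
    have b: "0 \<le> b"
    proof -
      have "k * k \<le> 1 * k" using k by (intro mult_right_mono) auto
      then show ?thesis using k unfolding b_def power2_eq_square by linarith
    qed
    have pw: "p\<^sup>2 * w = p ^ 3 + k * p * x"
      unfolding w_def p\<rho>[symmetric] by algebra
    have pl: "p\<^sup>2 * l = 2 * p\<^sup>2 - 4 * (p * (1 - k)) * x - b * x\<^sup>2 - k\<^sup>2 * x ^ 3"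
      unfolding l_def b_def p\<rho>[symmetric] by algebra
    have "0 \<le> p\<^sup>2 * (27/100 * w - l)"
    proof -
      have "(27/100 * k * p + 4 * (p * (1 - k))) * (2/3) \<le> (27/100 * k * p + 4 * (p * (1 - k))) * x"
        using x k p by (intro mult_left_mono) auto
      moreover have "b * (2/3)\<^sup>2 \<le> b * x\<^sup>2" using b x by (intro mult_left_mono power_mono) auto
      moreover have "k\<^sup>2 * (2/3) ^ 3 \<le> k\<^sup>2 * x ^ 3" using x by (intro mult_left_mono power_mono) auto
      moreover have "p\<^sup>2 * (27/100 * w - l) = 27/100 * p ^ 3 - 2 * p\<^sup>2
          + (27/100 * k * p + 4 * (p * (1 - k))) * x + b * x\<^sup>2 + k\<^sup>2 * x ^ 3"
        using pw pl by (simp add: algebra_simps)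
      \<comment> \<open>The cubic in \<open>p\<close> is split at 13/10, close to its local minimum,
        so that positivity can be read off.\<close>
      moreover have "27 * (27/100 * p ^ 3 - 2 * p\<^sup>2 + (27/100 * k * p + 4 * (p * (1 - k))) * (2/3)
          + b * (2/3)\<^sup>2 + k\<^sup>2 * (2/3) ^ 3)
        = (p - 13/10)\<^sup>2 * (729/100 * p + 4094/1000) + 443/10000 * p + 108114/100000"
        unfolding b_def kp by (simp add: power2_eq_square power3_eq_cube field_simps)
      moreover have "0 \<le> (p - 13/10)\<^sup>2 * (729/100 * p + 4094/1000)" using p by simp
      ultimately show ?thesis using p by argo
    qed
    moreover have "0 \<le> p\<^sup>2 * (27/100 * w + l)"
    proof -
      have "4 * (p * (1 - k)) * x \<le> 4 * (p * (1 - k)) * (77/100)"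
        using x k p by (intro mult_left_mono) auto
      moreover have "b * x\<^sup>2 \<le> b * (77/100)\<^sup>2" using b x by (intro mult_left_mono power_mono) auto
      moreover have "k\<^sup>2 * x ^ 3 \<le> k\<^sup>2 * (77/100) ^ 3" using x by (intro mult_left_mono power_mono) auto
      moreover have "0 \<le> 27/100 * (k * p * x)" using k p x by simp
      moreover have "p\<^sup>2 * (27/100 * w + l) = 27/100 * p ^ 3 + 27/100 * (k * p * x) + 2 * p\<^sup>2
          - 4 * (p * (1 - k)) * x - b * x\<^sup>2 - k\<^sup>2 * x ^ 3"
        using pw pl by (simp add: algebra_simps)
      moreover have "27/100 * p ^ 3 + 2 * p\<^sup>2
          - 4 * (p * (1 - k)) * (77/100) - b * (77/100)\<^sup>2 - k\<^sup>2 * (77/100) ^ 3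
        = 27/100 * p ^ 3 + 242167/1000000 * p\<^sup>2 + 162932/1000000 * p - 640332/1000000"
        unfolding b_def kp by (simp add: power2_eq_square power3_eq_cube field_simps)
      moreover have "1 \<le> p ^ 3" "1 \<le> p\<^sup>2" using p by (simp_all add: one_le_power)
      ultimately show ?thesis using p by argo
    qed
    ultimately have "\<bar>l\<bar> \<le> 27/100 * w"
      using p by (auto simp: zero_le_mult_iff abs_le_iff)
    then show ?thesis
      using w unfolding quintic_y_def p_def[symmetric] w_def[symmetric] l_def[symmetric]
      by (simp add: divide_le_eq)
  qed
  ultimately show ?thesis using that[of \<rho>] x by (simp add: p_def[symmetric] p\<rho>)
qed

section \<open>Quintic parameters outside the compact interval\<close>

text \<open>The constant is matched to the bound 27/100 at the root, as
  \<open>2 * (27/100)\<^sup>2 < (2/5)\<^sup>2\<close>. To the left of the interval the numerator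
  \<open>l\<close> is at least \<open>2/5 * w\<close>, to the right at most
  \<open>- 2/5 * w\<close>.\<close>

lemma quintic_y_large:
  fixes k \<rho> :: real
  assumes k: "0 < k" "k \<le> 1" and pos: "0 < 1 + k * \<rho>" and \<rho>: "- (1/10) < \<rho>"
    and out: "(2 - k) * \<rho> < 1/2 \<or> 6/5 < (2 - k) * \<rho>"
  shows "2/5 \<le> \<bar>quintic_y k \<rho>\<bar>"
proof -
  define p where "p = 2 - k"
  have p: "1 \<le> p" "p \<le> 2" and kp: "k = 2 - p" using k by (simp_all add: p_def)
  define b where "b = 2 + 4 * k - 3 * k\<^sup>2"
  define x where "x = p * \<rho>"
  define w where "w = p + k * \<rho>"
  define l where "l = 2 - 4 * (1 - k) * \<rho> - b * \<rho>\<^sup>2 - k\<^sup>2 * p * \<rho> ^ 3"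
  have w: "0 < w" using pos p kp unfolding w_def by linarith
  have kk: "k * k \<le> 1 * k" using k by (intro mult_right_mono) auto
  then have b: "2 \<le> b" "b \<le> 6"
    using k zero_le_power2[of k] unfolding b_def power2_eq_square by linarith+
  have pp: "p\<^sup>2 \<le> 2 * p" "p ^ 3 \<le> 2 * p\<^sup>2" "p\<^sup>2 \<le> 4"
    using p power_mono[of p 2 2] by (auto simp: power2_eq_square power3_eq_cube)
  have pw: "p\<^sup>2 * w = p ^ 3 + k * p * x"
    unfolding w_def x_def by algebra
  have pl: "p\<^sup>2 * l = 2 * p\<^sup>2 - 4 * (p * (1 - k)) * x - b * x\<^sup>2 - k\<^sup>2 * x ^ 3"
    unfolding l_def x_def by algebra
  consider "\<rho> < 0" | "0 \<le> \<rho>" "x < 1/2" | "6/5 < x"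
    using out unfolding x_def p_def by linarith
  then have "2/5 * w \<le> \<bar>l\<bar>"
  proof cases
    case 1
    have "(1 - k) * \<rho> \<le> 0" "k\<^sup>2 * p * \<rho> ^ 3 \<le> 0" "k * \<rho> \<le> 0"
      using 1 k p by (auto simp: mult_nonneg_nonpos power3_eq_cube mult_nonneg_nonpos2)
    moreover have "b * \<rho>\<^sup>2 \<le> 6 * (1/10)\<^sup>2"
      using b 1 \<rho> by (intro mult_mono) (auto simp: abs_le_square_iff[symmetric])
    then have "b * \<rho>\<^sup>2 \<le> 6/100" by (simp add: power2_eq_square)
    moreover have "l = 2 - 4 * ((1 - k) * \<rho>) - b * \<rho>\<^sup>2 - k\<^sup>2 * p * \<rho> ^ 3" by (simp add: l_def)
    ultimately have "2/5 * w \<le> l" using p unfolding w_def by argo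
    then show ?thesis by linarith
  next
    case 2
    have x: "0 \<le> x" using 2 p by (simp add: x_def)
    have "(2/5 * (k * p) + 4 * (p * (1 - k))) * x \<le> (2/5 * (k * p) + 4 * (p * (1 - k))) * (1/2)"
      using 2 k p by (intro mult_left_mono) auto
    moreover have "b * x\<^sup>2 \<le> b * (1/2)\<^sup>2" using b 2 x by (intro mult_left_mono power_mono) auto
    moreover have "k\<^sup>2 * x ^ 3 \<le> k\<^sup>2 * (1/2) ^ 3" using 2 x by (intro mult_left_mono power_mono) auto
    moreover have "p\<^sup>2 * (l - 2/5 * w) = 2 * p\<^sup>2 - 2/5 * p ^ 3
        - (2/5 * (k * p) + 4 * (p * (1 - k))) * x - b * x\<^sup>2 - k\<^sup>2 * x ^ 3"
      using pw pl by (simp add: algebra_simps)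
    moreover have "2 * p\<^sup>2 - 2/5 * p ^ 3 - (2/5 * (k * p) + 4 * (p * (1 - k))) * (1/2)
        - b * (1/2)\<^sup>2 - k\<^sup>2 * (1/2) ^ 3 = 33/40 * p\<^sup>2 + 1/10 * p - 2/5 * p ^ 3"
      unfolding b_def kp by (simp add: power2_eq_square power3_eq_cube field_simps)
    ultimately have "0 \<le> p\<^sup>2 * (l - 2/5 * w)" using pp p zero_le_power2[of p] by argo
    then show ?thesis using p by (simp add: zero_le_mult_iff)
  next
    case 3
    \<comment> \<open>Replacing one factor of \<open>x\<^sup>2\<close> by 6/5 makes the main part
      linear in \<open>x\<close> with nonnegative slope, so it can be checked at
      \<open>x = 6/5\<close>.\<close>
    have "b * x * (6/5) \<le> b * x * x" using b 3 by (intro mult_left_mono) auto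
    moreover have "k\<^sup>2 * (6/5) ^ 3 \<le> k\<^sup>2 * x ^ 3" using 3 by (intro mult_left_mono power_mono) auto
    moreover have "(4 * (p * (1 - k)) - 2/5 * (k * p) + 6/5 * b) * (6/5)
        \<le> (4 * (p * (1 - k)) - 2/5 * (k * p) + 6/5 * b) * x"
    proof (rule mult_left_mono)
      have "k * p \<le> 1 * 2" using k p by (intro mult_mono) auto
      moreover have "0 \<le> p * (1 - k)" using k p by simp
      ultimately show "0 \<le> 4 * (p * (1 - k)) - 2/5 * (k * p) + 6/5 * b" using b by linarith
    qed (use 3 in simp)
    moreover have "p\<^sup>2 * (- l - 2/5 * w) = (4 * (p * (1 - k)) - 2/5 * (k * p) + 6/5 * b) * x
        + (b * x * x - b * x * (6/5)) + k\<^sup>2 * x ^ 3 - 2 * p\<^sup>2 - 2/5 * p ^ 3"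
      using pw pl by (simp add: power2_eq_square algebra_simps)
    moreover have "(4 * (p * (1 - k)) - 2/5 * (k * p) + 6/5 * b) * (6/5)
        + k\<^sup>2 * (6/5) ^ 3 - 2 * p\<^sup>2 - 2/5 * p ^ 3
      = 688/1000 * p\<^sup>2 - 1152/1000 * p + 4032/1000 - 2/5 * p ^ 3"
      unfolding b_def kp by (simp add: power2_eq_square power3_eq_cube field_simps)
    ultimately have "0 \<le> p\<^sup>2 * (- l - 2/5 * w)" using pp p by argo
    then show ?thesis using p by (simp add: zero_le_mult_iff)
  qed
  then show ?thesis
    using w unfolding quintic_y_def p_def[symmetric] w_def[symmetric] b_def[symmetric] l_def[symmetric]
    by (simp add: le_divide_eq)
qed

text \<open>For negative \<open>\<rho>\<close> every term of the quadratic factor is nonnegative, so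
  the factor is at least 2, while the denominator is at most 2.\<close>

lemma quintic_x_large:
  fixes k \<rho> :: real
  assumes k: "0 < k" "k \<le> 1" and pos: "0 < 1 + k * \<rho>" and \<rho>: "\<rho> \<le> - (1/10)"
  shows "1/10 \<le> quintic_x k \<rho>"
proof -
  define q where "q = 2 - 3 * (2 - k) * \<rho> + (2 - k) * (1 - k) * \<rho>\<^sup>2"
  define w where "w = 2 - k + k * \<rho>"
  have w: "0 < w" using pos k unfolding w_def by linarith
  have "k * \<rho> \<le> 0" using k \<rho> by (intro mult_nonneg_nonpos) auto
  then have w_le: "w \<le> 2" using k unfolding w_def by linarith
  have "(2 - k) * \<rho> \<le> 0" "0 \<le> (2 - k) * (1 - k) * \<rho>\<^sup>2"
    using k \<rho> by (auto intro: mult_nonneg_nonpos)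
  moreover have "q = 2 - 3 * ((2 - k) * \<rho>) + (2 - k) * (1 - k) * \<rho>\<^sup>2" by (simp add: q_def)
  ultimately have "2 \<le> q" by argo
  then have "1/10 * 2 \<le> - \<rho> * q" using \<rho> by (intro mult_mono) auto
  then have "1/10 * w \<le> - (\<rho> * q)" using w_le by simp
  then show ?thesis
    using w unfolding quintic_x_def q_def[symmetric] w_def[symmetric] by (simp only: pos_le_divide_eq)
qed

lemma unique_best_5:
  fixes \<phi> :: real
  assumes \<phi>: "0 < \<phi>" "\<phi> \<le> pi / 2" and h: "error_scale h"
  shows "\<exists>!d. is_arg_min (\<lambda>d. max_abs (\<lambda>t. h (simp_radial_error \<phi> 5 t d)))
    (\<lambda>d. d \<in> admissible \<phi> 5) d"
proof -
  define k s p where "k = 1 - cos \<phi>" and "s = sin \<phi>" and "p = 2 - k"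
  have k: "0 < k" "k \<le> 1" and s: "0 < s" and s2: "s\<^sup>2 = k * (2 - k)"
    using cos_sin_half_period[OF \<phi>] by (simp_all add: k_def s_def)
  have p: "1 \<le> p" "p \<le> 2" using k by (simp_all add: p_def)
  have s_le: "s\<^sup>2 \<le> 1" by (simp add: s_def abs_square_le_1)
  obtain \<rho>\<^sub>0 where \<rho>\<^sub>0: "2/3 \<le> p * \<rho>\<^sub>0" "p * \<rho>\<^sub>0 \<le> 77/100" "quintic_x k \<rho>\<^sub>0 = 0"
    "\<bar>quintic_y k \<rho>\<^sub>0\<bar> \<le> 27/100"
    using quintic_root[OF k] unfolding p_def by blast
  \<comment> \<open>\<open>\<delta>\<close> and \<open>R\<close> are mutually inverse increasing
    affine maps between \<open>\<rho>\<close> and \<open>d\<close>; conditions on \<open>d\<close>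
    are checked in terms of \<open>\<rho>\<close>.\<close>
  define \<delta> where "\<delta> \<rho> = 2 * s * (1 + k * \<rho>) / 5" for \<rho>
  define R where "R d = (5 * d / (2 * s) - 1) / k" for d
  have \<delta>_R: "\<delta> (R d) = d" and R_\<delta>: "R (\<delta> \<rho>) = \<rho>" and R_pos: "1 + k * R d = 5 * d / (2 * s)" for d \<rho>
    using k s by (simp_all add: \<delta>_def R_def)
  have R_less: "R d < R d'" if "d < d'" for d d'
    using that k s unfolding R_def by (intro divide_strict_right_mono diff_strict_right_mono) auto
  have R_le: "R d \<le> R d' \<longleftrightarrow> d \<le> d'" for d d'
    using R_less[of d d'] R_less[of d' d] by fastforce
  define X Y where "X d = 1 + k ^ 4 / 8 * quintic_x k (R d)"
    and "Y d = s * k\<^sup>2 / 8 * quintic_y k (R d)" for d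
  define J where "J = {\<delta> (1 / (2 * p))..\<delta> (6 / (5 * p))}"
  have J_iff: "d \<in> J \<longleftrightarrow> 1/2 \<le> p * R d \<and> p * R d \<le> 6/5" for d
  proof -
    have "d \<in> J \<longleftrightarrow> 1 / (2 * p) \<le> R d \<and> R d \<le> 6 / (5 * p)"
      unfolding J_def using R_le[of "\<delta> (1 / (2 * p))" d] R_le[of d "\<delta> (6 / (5 * p))"]
      by (simp add: R_\<delta>)
    then show ?thesis using p by (simp add: field_simps)
  qed
  have w: "2 - k + k * R d \<noteq> 0" if "d \<in> J" for d
    using quintic_deriv_bounds(1)[OF k, of "R d"] that unfolding J_iff p_def by linarith
  have X_pos: "0 < X d" if "d \<in> J" for d
  proof -
    have "- (6/5) \<le> quintic_x k (R d)"
      using quintic_deriv_bounds(5)[OF k, of "R d"] that unfolding J_iff p_def by blast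
    then have "k ^ 4 / 8 * (- (6/5)) \<le> k ^ 4 / 8 * quintic_x k (R d)"
      using k by (intro mult_left_mono) auto
    moreover have "k ^ 4 \<le> 1" using k by (simp add: power_le_one)
    ultimately show ?thesis unfolding X_def by argo
  qed
  have Y2: "(Y d)\<^sup>2 = s\<^sup>2 * k ^ 4 / 64 * (quintic_y k (R d))\<^sup>2" for d
    by (simp add: Y_def power_mult_distrib power_divide power_mult[symmetric])
  define a where "a = s\<^sup>2 * k ^ 4 / 64"
  have a: "0 < a" "a \<le> k ^ 4 / 64"
    using s k mult_right_mono[OF s_le, of "k ^ 4"] by (simp_all add: a_def)
  define d0 where "d0 = \<delta> \<rho>\<^sub>0"
  have Y_d0: "(Y d0)\<^sup>2 \<le> a * (729/10000)"
  proof -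
    have "\<bar>quintic_y k \<rho>\<^sub>0\<bar>\<^sup>2 \<le> (27/100)\<^sup>2" using \<rho>\<^sub>0(4) by (intro power_mono) auto
    then have "(quintic_y k \<rho>\<^sub>0)\<^sup>2 \<le> 729/10000" by (simp add: power2_eq_square)
    then show ?thesis
      unfolding Y2 d0_def R_\<delta> a_def[symmetric] using a by (intro mult_left_mono) auto
  qed
  have k4: "0 < k ^ 4" "k ^ 4 \<le> 1" using k by (auto simp: power_le_one)

  show ?thesis
  proof (rule unique_best_parameter[where h = h and \<psi> = "simp_radial_error \<phi> 5" and X = X and Y = Y
        and m = 4 and \<sigma> = 1 and J = J and ?d0.0 = d0])
    show "simp_radial_error \<phi> 5 t d = (1 - t\<^sup>2) ^ 4 * ((X d)\<^sup>2 - 1 + 1 * (Y d)\<^sup>2 * t\<^sup>2)"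
      if "d \<in> admissible \<phi> 5" for t d
      using simp_radial_error_5_scaled[OF \<phi>, of "R d" t, folded k_def s_def, folded \<delta>_def] that
      unfolding \<delta>_R X_def Y_def by (simp add: admissible_def)
    show "J \<subseteq> admissible \<phi> 5"
    proof
      fix d assume "d \<in> J"
      then have "0 \<le> p * R d" by (simp add: J_iff)
      then have "0 \<le> R d" using p by (simp add: zero_le_mult_iff)
      then have "0 < 5 * d / (2 * s)" using k unfolding R_pos[symmetric] by (simp add: add_pos_nonneg)
      then show "d \<in> admissible \<phi> 5" using s by (simp add: admissible_def zero_less_divide_iff)
    qed
    show "d0 \<in> J" using \<rho>\<^sub>0 by (simp add: J_iff d0_def R_\<delta>)
    show "(X d0)\<^sup>2 = 1" using \<rho>\<^sub>0 by (simp add: X_def d0_def R_\<delta>)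
    show "(Y d0)\<^sup>2 \<le> 2" using Y_d0 a k4 by linarith
    have R_cont: "continuous_on J R" unfolding R_def by (intro continuous_intros) (use s k in auto)
    have "continuous_on (R ` J) (quintic_x k)" "continuous_on (R ` J) (quintic_y k)"
      using w by (auto intro!: continuous_at_imp_continuous_on DERIV_isCont
          quintic_x_deriv quintic_y_deriv)
    from this[THEN continuous_on_compose2, OF R_cont order_refl]
    show "continuous_on J X" "continuous_on J Y"
      unfolding X_def Y_def by (intro continuous_intros; simp)+
    show "(X d)\<^sup>2 < (X d')\<^sup>2" if d: "d \<in> J" "d' \<in> J" "d < d'" for d d'
      using quintic_mono(1)[OF k s2, of "R d" "R d'"] R_less[OF d(3)] X_pos[OF d(1)] d
      unfolding J_iff p_def X_def by (intro power_strict_mono) auto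
    show "(X d)\<^sup>2 + 1 * (Y d)\<^sup>2 \<le> (X d')\<^sup>2 + 1 * (Y d')\<^sup>2"
      if d: "d \<in> J" "d' \<in> J" "d < d'" for d d'
      using quintic_mono(2)[OF k s2, of "R d" "R d'"] R_less[OF d(3)] d
      unfolding J_iff p_def X_def Y_def by simp
    show "(Y d0)\<^sup>2 < 2 * \<bar>(X d)\<^sup>2 - 1\<bar> \<or> 2 * (Y d0)\<^sup>2 < (Y d)\<^sup>2"
      if d: "d \<in> admissible \<phi> 5" "d \<notin> J" for d
    proof -
      have pos: "0 < 1 + k * R d" unfolding R_pos using d s by (simp add: admissible_def)
      show ?thesis
      \<comment> \<open>Far to the left \<open>X\<close> exceeds 1 by at least
        \<open>k ^ 4 / 80\<close>, which outweighs \<open>(Y d0)\<^sup>2\<close>; for the other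
        parameters off \<open>J\<close>, \<open>Y\<close> is too large.\<close>
      proof (cases "R d \<le> - (1/10)")
        case True
        have "k ^ 4 / 8 * (1/10) \<le> k ^ 4 / 8 * quintic_x k (R d)"
          using quintic_x_large[OF k pos True] k4 by (intro mult_left_mono) auto
        then have "1 + k ^ 4 / 80 \<le> X d" by (simp add: X_def)
        moreover from this have "1 \<le> X d" using k4 by linarith
        ultimately have "1 * (1 + k ^ 4 / 80) \<le> X d * X d" by (intro mult_mono) auto
        then have "(Y d0)\<^sup>2 < 2 * \<bar>(X d)\<^sup>2 - 1\<bar>"
          using Y_d0 a k4 abs_ge_self[of "(X d)\<^sup>2 - 1"] unfolding power2_eq_square[of "X d"] by argo
        then show ?thesis ..
      next
        case False
        have "2/5 \<le> \<bar>quintic_y k (R d)\<bar>"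
          using False d(2) unfolding J_iff p_def by (intro quintic_y_large[OF k pos]) auto
        then have "(2/5)\<^sup>2 \<le> \<bar>quintic_y k (R d)\<bar>\<^sup>2" by (intro power_mono) auto
        then have "a * (4/25) \<le> (Y d)\<^sup>2"
          unfolding Y2 a_def[symmetric] using a by (intro mult_left_mono) (auto simp: power2_eq_square)
        then have "2 * (Y d0)\<^sup>2 < (Y d)\<^sup>2" using Y_d0 a by argo
        then show ?thesis ..
      qed
    qed
  qed (use h in \<open>auto simp: simp_radial_error_ge J_def\<close>)
qed

section \<open>Assembly of the four degrees and both error measures\<close>

theorem mainTheorem1:
  fixes \<phi> :: real and n :: nat
  assumes "0 < \<phi>" and "\<phi> \<le> pi / 2" and "n \<in> {2, 3, 4, 5}"
  shows "(\<exists>!d. is_arg_min (\<lambda>d. max_abs (\<lambda>t. radial_error \<phi> n t d))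
                 (\<lambda>d. d \<in> admissible \<phi> n) d) \<and>
         (\<exists>!d. is_arg_min (\<lambda>d. max_abs (\<lambda>t. simp_radial_error \<phi> n t d))
                 (\<lambda>d. d \<in> admissible \<phi> n) d)"
proof -
  have unique: "\<exists>!d. is_arg_min (\<lambda>d. max_abs (\<lambda>t. h (simp_radial_error \<phi> n t d)))
      (\<lambda>d. d \<in> admissible \<phi> n) d" if h: "error_scale h" for h
  proof -
    consider "n = 2" | "n = 3" | "n = 4" | "n = 5" using assms(3) by blast
    then show ?thesis
      by cases (simp_all only: unique_best_2[OF assms(1,2) h] unique_best_3[OF assms(1,2) h]
          unique_best_4[OF assms(1,2) h] unique_best_5[OF assms(1,2) h])
  qed
  have "radial_error \<phi> n t d = sqrt (1 + simp_radial_error \<phi> n t d) - 1" for t d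
    by (simp add: radial_error_def simp_radial_error_def)
  then show ?thesis
    using unique[OF error_scale_sqrt] unique[OF error_scale_id] by simp
qed

end
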